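(* Let $\mathbf{X}=(X_n)_{n\in\mathbb{Z}}$ be a stationary, ergodic and almost surely continuous process with values in a finite non-empty alphabet $A$. For each $n\geq1$, let $\widehat P_{n,\delta,-}$, $\widehat P_n$ and $\widehat F_{n,\delta}$ be the estimators defined in the context, computed from the sample $X_1^n$ with confidence parameter $\delta=\delta_n\in(0,1)$, where $\sum_n\delta_n<+\infty$ and $\lim_{n\to\infty}\log(1/\delta_n)/n=0$. Then there exists a set $\mathcal{T}\subset A^{\mathbb{Z}_-}$ with $\mathbb{P}_{past}(\mathcal{T})=1$ such that, with probability $1$ over the sample $X_1^{+\infty}$, for all $x\in\mathcal{T}$ and $k\in\mathbb{N}$, as $n\to+\infty$, $$\widehat F_{n,\delta_n}(k|x^{-1}_{-k})\to\mathbb{P}\left(K_0\leq k\mid X^{-1}_{-\infty}=x\right)\quad\text{and}\quad d_{\rm TV}\left(p(\cdot|x),\widehat P_n(\cdot|x)\right)\to0.$$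
   Context: Notation. $\mathbb{N}=\{0,1,2,\dots\}$; $A^{\mathbb{Z}_-}$ is the set of infinite pasts $x=(\dots,x_{-2},x_{-1})$; $x^{-1}_{-k}=(x_{-k},\dots,x_{-1})$, equal to the empty string $o$ when $k=0$. $\mathbb{P}_{past}$ is the law of $X^{-1}_{-\infty}$ on $A^{\mathbb{Z}_-}$. $A^*$ is the set of finite strings over $A$ including $o$; $|w|$ is length; $wa$ is concatenation; $w\preceq u$ (or $u\succeq w$) means $w$ is a suffix of $u$. $d_{\rm TV}(p,q)=\frac12\sum_{a\in A}|p(a)-q(a)|$. Process quantities. $\mathrm{supp}^*(\mathbf{X})=\{w\in A^*:\mathbb{P}(X^{-1}_{-|w|}=w)>0\}$; for $w\in\mathrm{supp}^*(\mathbf{X})$, $p(a|w)=\mathbb{P}(X_0=a\mid X^{-1}_{-|w|}=w)$ and $p_-(a|w)=\inf_{w'\in\mathrm{supp}^*(\mathbf{X}),w'\succeq w}p(a|w')$; for $w\in A^*\setminus\mathrm{supp}^*(\mathbf{X})$, $p_-(a|w):=p_-(a|u)$ with $u$ the longest suffix of $w$ in $\mathrm{supp}^*(\mathbf{X})$. $\mathbf{X}$ is almost surely continuous if $\mathrm{ct}(X^{-1}_{-k})\to0$ almost surely as $k\to\infty$, where $\mathrm{ct}(w)=\sup_{w'\in\mathrm{supp}^*(\mathbf{X}),w'\succeq w}d_{\rm TV}(p(\cdot|w'),p(\cdot|w))$. $p(a|x)$ for $x\in A^{\mathbb{Z}_-}$ is the version of $\mathbb{P}(X_0=a\mid X^{-1}_{-\infty}=x)$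 given by $p(a|x)=\lim_kp_-(a|x^{-1}_{-k})+\big(1-\sum_{b\in A}\lim_kp_-(b|x^{-1}_{-k})\big)/|A|$. $(X_n,K_n)_{n\in\mathbb{Z}}$ is the minimal random context representation of $\mathbf{X}$: a stationary process with values in $A\times(\mathbb{N}\cup\{+\infty\})$, with $K_0<+\infty$ a.s., such that for all $a\in A$, $k\in\mathbb{N}$, a.s. $\mathbb{P}(X_0=a,K_0\leq k\mid X^{-1}_{-\infty})=\mathbb{P}(X_0=a,K_0\leq k\mid X^{-1}_{-k})=p_-(a|X^{-1}_{-k})$. In particular $\mathbb{P}(K_0\leq k\mid X^{-1}_{-\infty}=x)=\sum_{a\in A}p_-(a|x^{-1}_{-k})$ for $\mathbb{P}_{past}$-a.e. $x$. The estimators (sample $X_1^n$, parameter $\delta$). For $w\in A^*$, $N_j(w)=\#\{i: |w|\leq i\leq j,\ X^i_{i-|w|+1}=w\}$ (for $w=o$ the condition is void and $i$ ranges over $0,\dots,j$). For $a\in A$: $\widehat p_n(a|w)=N_n(wa)/N_{n-1}(w)$ if $N_{n-1}(w)>0$, and $1/|A|$ otherwise. Let $$t_{*,n}(\delta)=\ln\left(\frac{|A|\,(14+2\log_2 n)\,(1+\frac{n^2}{2})}{\delta}\right),$$ $$\widehat{\mathsf{cf}}_{n,\delta}(w,a)=2\sqrt{\widehat p_n(a|w)\frac{t_{*,n}(\delta)}{N_{n-1}(w)}}+(2+\sqrt2)\frac{t_{*,n}(\delta)}{N_{n-1}(w)}\ \text{ if }N_{n-1}(w)>0,\qquad \widehat{\mathsf{cf}}_{n,\delta}(w,a)=1\text{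 if }N_{n-1}(w)=0,$$ $$\widehat p_{n,\delta,-}(a|w)=\min_{w'\in A^*,\,w'\succeq w}\left(\widehat p_n(a|w')+\widehat{\mathsf{cf}}_{n,\delta}(w',a)\right).$$ For $x\in A^{\mathbb{Z}_-}$, $\widehat h_n(x)=\min\{h\in\mathbb{N}:\sum_{a\in A}\widehat p_{n,\delta,-}(a|x^{-1}_{-h})\geq1\}$ (always finite). With $h=\widehat h_n(x)$ and the convention that $\widehat p_{n,\delta,-}(a|x^{-1}_{-h+1}):=0$ for all $a$ when $h=0$, let $\widehat Z_n(x)=\sum_{b\in A}(\widehat p_{n,\delta,-}(b|x^{-1}_{-h})-\widehat p_{n,\delta,-}(b|x^{-1}_{-h+1}))>0$, $\widehat z_n(x)=1-\sum_{b\in A}\widehat p_{n,\delta,-}(b|x^{-1}_{-h+1})$, and $$\widehat P_n(a|x)=\Big(1-\frac{\widehat z_n(x)}{\widehat Z_n(x)}\Big)\widehat p_{n,\delta,-}(a|x^{-1}_{-h+1})+\frac{\widehat z_n(x)}{\widehat Z_n(x)}\,\widehat p_{n,\delta,-}(a|x^{-1}_{-h}).$$ Finally $\widehat P_{n,\delta,-}(a|x^{-1}_{-k})=\widehat p_{n,\delta,-}(a|x^{-1}_{-k})$ if $k<\widehat h_n(x)$ and $\widehat P_{n,\delta,-}(a|x^{-1}_{-k})=\widehat P_n(a|x)$ if $k\geq\widehat h_n(x)$; and $\widehat F_{n,\delta}(k|x^{-1}_{-k})=\sum_{a\in A}\widehat P_{n,\delta,-}(a|x^{-1}_{-k})$.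 *)

theory Defs
  imports "HOL-Probability.Probability" "HOL-Library.Sublist"
begin

text \<open>A process is a family of random variables indexed by \<^typ>\<open>int\<close>. The state space is always
  countable (the alphabet, a type of class \<^class>\<open>finite\<close>, or pairs of a letter and an
  \<^typ>\<open>enat\<close>), so it carries the discrete sigma-algebra.\<close>

definition process :: "'w measure \<Rightarrow> (int \<Rightarrow> 'w \<Rightarrow> 's::countable) \<Rightarrow> bool" where
  "process M X \<longleftrightarrow> prob_space M \<and> (\<forall>n. X n \<in> measurable M (count_space UNIV))"

definition path_law :: "'w measure \<Rightarrow> (int \<Rightarrow> 'w \<Rightarrow> 's::countable) \<Rightarrow> (int \<Rightarrow> 's) measure" where
  "path_law M X = distr M (\<Pi>\<^sub>M i\<in>UNIV. count_space UNIV) (\<lambda>\<omega> n. X n \<omega>)"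

definition stationary :: "'w measure \<Rightarrow> (int \<Rightarrow> 'w \<Rightarrow> 's::countable) \<Rightarrow> bool" where
  "stationary M X \<longleftrightarrow> process M X \<and> (\<forall>m. path_law M (\<lambda>n. X (n + m)) = path_law M X)"

definition ergodic :: "'w measure \<Rightarrow> (int \<Rightarrow> 'w \<Rightarrow> 's::countable) \<Rightarrow> bool" where
  "ergodic M X \<longleftrightarrow>
     (\<forall>B \<in> sets (path_law M X). (\<lambda>y n. y (n + 1)) -` B = B \<longrightarrow>
        measure (path_law M X) B = 0 \<or> measure (path_law M X) B = 1)"

text \<open>\<open>block y i j\<close> is the word \<open>(y i, \<dots>, y j)\<close>, empty if \<open>j < i\<close>.\<close>

definition block :: "(int \<Rightarrow> 's) \<Rightarrow> int \<Rightarrow> int \<Rightarrow> 's list" where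
  "block y i j = map y [i..j]"

text \<open>Infinite pasts are the extensional functions on \<^term>\<open>{..<0::int}\<close>;
  \<open>suffix_of_past x k\<close> consists of the last \<open>k\<close> letters of \<open>x\<close>. It only looks at negative
  indices, so it is applied to full paths as well.\<close>

definition past_space :: "(int \<Rightarrow> 's::countable) measure" where
  "past_space = (\<Pi>\<^sub>M i\<in>{..<0}. count_space UNIV)"

definition past :: "(int \<Rightarrow> 'w \<Rightarrow> 's) \<Rightarrow> 'w \<Rightarrow> int \<Rightarrow> 's" where
  "past X \<omega> = (\<lambda>n\<in>{..<0}. X n \<omega>)"

definition past_law :: "'w measure \<Rightarrow> (int \<Rightarrow> 'w \<Rightarrow> 's::countable) \<Rightarrow> (int \<Rightarrow> 's) measure" where
  "past_law M X = distr M past_space (past X)"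

definition suffix_of_past :: "(int \<Rightarrow> 's) \<Rightarrow> nat \<Rightarrow> 's list" where
  "suffix_of_past x k = block x (- int k) (-1)"

definition dTV :: "('a::finite \<Rightarrow> real) \<Rightarrow> ('a \<Rightarrow> real) \<Rightarrow> real" where
  "dTV p q = (\<Sum>a\<in>UNIV. \<bar>p a - q a\<bar>) / 2"

definition supp_star :: "'w measure \<Rightarrow> (int \<Rightarrow> 'w \<Rightarrow> 'a) \<Rightarrow> 'a list set" where
  "supp_star M X = {w. \<P>(\<omega> in M. suffix_of_past (\<lambda>n. X n \<omega>) (length w) = w) > 0}"

definition p_word :: "'w measure \<Rightarrow> (int \<Rightarrow> 'w \<Rightarrow> 'a) \<Rightarrow> 'a \<Rightarrow> 'a list \<Rightarrow> real" where
  "p_word M X a w =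
     \<P>(\<omega> in M. X 0 \<omega> = a \<bar> suffix_of_past (\<lambda>n. X n \<omega>) (length w) = w)"

definition longest_supp_suffix :: "'w measure \<Rightarrow> (int \<Rightarrow> 'w \<Rightarrow> 'a) \<Rightarrow> 'a list \<Rightarrow> 'a list" where
  "longest_supp_suffix M X w = (ARG_MAX length u. suffix u w \<and> u \<in> supp_star M X)"

definition p_minus_supp :: "'w measure \<Rightarrow> (int \<Rightarrow> 'w \<Rightarrow> 'a) \<Rightarrow> 'a \<Rightarrow> 'a list \<Rightarrow> real" where
  "p_minus_supp M X a w = (INF w'\<in>{w' \<in> supp_star M X. suffix w w'}. p_word M X a w')"

definition p_minus :: "'w measure \<Rightarrow> (int \<Rightarrow> 'w \<Rightarrow> 'a) \<Rightarrow> 'a \<Rightarrow> 'a list \<Rightarrow> real" where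
  "p_minus M X a w =
     (if w \<in> supp_star M X then p_minus_supp M X a w
      else p_minus_supp M X a (longest_supp_suffix M X w))"

text \<open>\<open>ct\<close> is only meaningful on \<open>supp_star M X\<close>, where the supremum is over a nonempty bounded
  set. Almost surely, every suffix of the past belongs to \<open>supp_star M X\<close>.\<close>

definition ct :: "'w measure \<Rightarrow> (int \<Rightarrow> 'w \<Rightarrow> 'a::finite) \<Rightarrow> 'a list \<Rightarrow> real" where
  "ct M X w = (SUP w'\<in>{w' \<in> supp_star M X. suffix w w'}.
                 dTV (\<lambda>a. p_word M X a w') (\<lambda>a. p_word M X a w))"

definition almost_surely_continuous :: "'w measure \<Rightarrow> (int \<Rightarrow> 'w \<Rightarrow> 'a::finite) \<Rightarrow> bool" where
  "almost_surely_continuous M X \<longleftrightarrow>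
     (AE \<omega> in M. (\<lambda>k. ct M X (suffix_of_past (\<lambda>n. X n \<omega>) k)) \<longlonglongrightarrow> 0)"

definition p_minus_lim :: "'w measure \<Rightarrow> (int \<Rightarrow> 'w \<Rightarrow> 'a) \<Rightarrow> 'a \<Rightarrow> (int \<Rightarrow> 'a) \<Rightarrow> real" where
  "p_minus_lim M X a x = lim (\<lambda>k. p_minus M X a (suffix_of_past x k))"

text \<open>A version of the conditional law of \<open>X 0\<close> given the infinite past: under almost sure
  continuity the limits sum to 1 for almost every past, and elsewhere the missing mass is spread
  uniformly.\<close>

definition p_past :: "'w measure \<Rightarrow> (int \<Rightarrow> 'w \<Rightarrow> 'a::finite) \<Rightarrow> 'a \<Rightarrow> (int \<Rightarrow> 'a) \<Rightarrow> real" where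
  "p_past M X a x =
     p_minus_lim M X a x + (1 - (\<Sum>b\<in>UNIV. p_minus_lim M X b x)) / real CARD('a)"

definition coord_algebra ::
    "'w measure \<Rightarrow> (int \<Rightarrow> 'w \<Rightarrow> 's::countable) \<Rightarrow> int set \<Rightarrow> 'w measure" where
  "coord_algebra M X I =
     vimage_algebra (space M) (\<lambda>\<omega>. \<lambda>n\<in>I. X n \<omega>) (\<Pi>\<^sub>M i\<in>I. count_space UNIV)"

definition cond_prob_given ::
    "'w measure \<Rightarrow> (int \<Rightarrow> 'w \<Rightarrow> 's::countable) \<Rightarrow> int set \<Rightarrow> ('w \<Rightarrow> bool) \<Rightarrow> 'w \<Rightarrow> real" where
  "cond_prob_given M X I E =
     real_cond_exp M (coord_algebra M X I) (indicator {\<omega> \<in> space M. E \<omega>})"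

definition version_given_past ::
    "'w measure \<Rightarrow> (int \<Rightarrow> 'w \<Rightarrow> 's::countable) \<Rightarrow> ('w \<Rightarrow> bool) \<Rightarrow> ((int \<Rightarrow> 's) \<Rightarrow> real) \<Rightarrow> bool"
  where
  "version_given_past M X E g \<longleftrightarrow>
     g \<in> borel_measurable past_space \<and>
     (AE \<omega> in M. cond_prob_given M X {..<0} E \<omega> = g (past X \<omega>))"

definition minimal_rcr ::
    "'w measure \<Rightarrow> (int \<Rightarrow> 'w \<Rightarrow> 'a::finite) \<Rightarrow> (int \<Rightarrow> 'w \<Rightarrow> enat) \<Rightarrow> bool" where
  "minimal_rcr M X K \<longleftrightarrow>
     stationary M (\<lambda>n \<omega>. (X n \<omega>, K n \<omega>)) \<and>
     (AE \<omega> in M. K 0 \<omega> < \<infinity>) \<and>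
     (\<forall>a k. AE \<omega> in M.
        cond_prob_given M X {..<0} (\<lambda>\<omega>. X 0 \<omega> = a \<and> K 0 \<omega> \<le> enat k) \<omega>
          = cond_prob_given M X {- int k..<0} (\<lambda>\<omega>. X 0 \<omega> = a \<and> K 0 \<omega> \<le> enat k) \<omega> \<and>
        cond_prob_given M X {- int k..<0} (\<lambda>\<omega>. X 0 \<omega> = a \<and> K 0 \<omega> \<le> enat k) \<omega>
          = p_minus M X a (suffix_of_past (\<lambda>n. X n \<omega>) k))"

text \<open>Below, \<open>s\<close> is a sample path, of which only \<open>s 1, \<dots>, s n\<close> enter the estimators of sample
  size \<open>n\<close>, and \<open>d\<close> is the confidence parameter.\<close>

definition occ :: "(int \<Rightarrow> 'a) \<Rightarrow> nat \<Rightarrow> 'a list \<Rightarrow> nat" where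
  "occ s j w =
     card {i. length w \<le> i \<and> i \<le> j \<and> block s (int i - int (length w) + 1) (int i) = w}"

definition p_hat :: "(int \<Rightarrow> 'a::finite) \<Rightarrow> nat \<Rightarrow> 'a \<Rightarrow> 'a list \<Rightarrow> real" where
  "p_hat s n a w =
     (if occ s (n - 1) w > 0 then real (occ s n (w @ [a])) / real (occ s (n - 1) w)
      else 1 / real CARD('a))"

definition t_star :: "'a::finite itself \<Rightarrow> nat \<Rightarrow> real \<Rightarrow> real" where
  "t_star _ n d =
     ln (real CARD('a) * (14 + 2 * log 2 (real n)) * (1 + (real n)\<^sup>2 / 2) / d)"

definition cf_hat :: "(int \<Rightarrow> 'a::finite) \<Rightarrow> nat \<Rightarrow> real \<Rightarrow> 'a list \<Rightarrow> 'a \<Rightarrow> real" where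
  "cf_hat s n d w a =
     (if occ s (n - 1) w > 0
      then 2 * sqrt (p_hat s n a w * (t_star TYPE('a) n d / real (occ s (n - 1) w)))
           + (2 + sqrt 2) * (t_star TYPE('a) n d / real (occ s (n - 1) w))
      else 1)"

text \<open>The minimum ranges over infinitely many words, but over finitely many values.\<close>

definition p_hat_minus :: "(int \<Rightarrow> 'a::finite) \<Rightarrow> nat \<Rightarrow> real \<Rightarrow> 'a \<Rightarrow> 'a list \<Rightarrow> real" where
  "p_hat_minus s n d a w =
     Min ((\<lambda>w'. p_hat s n a w' + cf_hat s n d w' a) ` {w'. suffix w w'})"

lemma finite_p_hat_minus_values:
  "finite ((\<lambda>w'. p_hat s n a w' + cf_hat s n d w' a) ` W)"
proof -
  have occ_le: "occ s j w \<le> Suc j" for j w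
    unfolding occ_def
    using card_mono[of "{..j}" "{i. length w \<le> i \<and> i \<le> j \<and>
      block s (int i - int (length w) + 1) (int i) = w}"] by auto
  define f where "f = (\<lambda>(u, v).
     (if v > 0 then real u / real v else 1 / real CARD('a)) +
     (if v > 0 then 2 * sqrt ((real u / real v) * (t_star TYPE('a) n d / real v))
        + (2 + sqrt 2) * (t_star TYPE('a) n d / real v) else 1))"
  have "(\<lambda>w'. p_hat s n a w' + cf_hat s n d w' a) w
      = f (occ s n (w @ [a]), occ s (n - 1) w)" for w
    by (simp add: f_def p_hat_def cf_hat_def)
  then have "(\<lambda>w'. p_hat s n a w' + cf_hat s n d w' a) ` W
      \<subseteq> f ` ({..Suc n} \<times> {..Suc (n - 1)})"
    using occ_le by fastforce
  then show ?thesis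
    by (rule finite_subset) auto
qed

definition h_hat :: "(int \<Rightarrow> 'a::finite) \<Rightarrow> nat \<Rightarrow> real \<Rightarrow> (int \<Rightarrow> 'a) \<Rightarrow> nat" where
  "h_hat s n d x = (LEAST h. (\<Sum>a\<in>UNIV. p_hat_minus s n d a (suffix_of_past x h)) \<ge> 1)"

definition p_hat_at :: "(int \<Rightarrow> 'a::finite) \<Rightarrow> nat \<Rightarrow> real \<Rightarrow> 'a \<Rightarrow> (int \<Rightarrow> 'a) \<Rightarrow> real" where
  "p_hat_at s n d a x = p_hat_minus s n d a (suffix_of_past x (h_hat s n d x))"

definition p_hat_before :: "(int \<Rightarrow> 'a::finite) \<Rightarrow> nat \<Rightarrow> real \<Rightarrow> 'a \<Rightarrow> (int \<Rightarrow> 'a) \<Rightarrow> real" where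
  "p_hat_before s n d a x =
     (if h_hat s n d x = 0 then 0
      else p_hat_minus s n d a (suffix_of_past x (h_hat s n d x - 1)))"

definition Z_hat :: "(int \<Rightarrow> 'a::finite) \<Rightarrow> nat \<Rightarrow> real \<Rightarrow> (int \<Rightarrow> 'a) \<Rightarrow> real" where
  "Z_hat s n d x = (\<Sum>b\<in>UNIV. p_hat_at s n d b x - p_hat_before s n d b x)"

definition z_hat :: "(int \<Rightarrow> 'a::finite) \<Rightarrow> nat \<Rightarrow> real \<Rightarrow> (int \<Rightarrow> 'a) \<Rightarrow> real" where
  "z_hat s n d x = 1 - (\<Sum>b\<in>UNIV. p_hat_before s n d b x)"

definition P_hat :: "(int \<Rightarrow> 'a::finite) \<Rightarrow> nat \<Rightarrow> real \<Rightarrow> 'a \<Rightarrow> (int \<Rightarrow> 'a) \<Rightarrow> real" where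
  "P_hat s n d a x =
     (1 - z_hat s n d x / Z_hat s n d x) * p_hat_before s n d a x
     + z_hat s n d x / Z_hat s n d x * p_hat_at s n d a x"

definition P_hat_minus ::
    "(int \<Rightarrow> 'a::finite) \<Rightarrow> nat \<Rightarrow> real \<Rightarrow> 'a \<Rightarrow> (int \<Rightarrow> 'a) \<Rightarrow> nat \<Rightarrow> real" where
  "P_hat_minus s n d a x k =
     (if k < h_hat s n d x then p_hat_minus s n d a (suffix_of_past x k) else P_hat s n d a x)"

definition F_hat :: "(int \<Rightarrow> 'a::finite) \<Rightarrow> nat \<Rightarrow> real \<Rightarrow> (int \<Rightarrow> 'a) \<Rightarrow> nat \<Rightarrow> real" where
  "F_hat s n d x k = (\<Sum>a\<in>UNIV. P_hat_minus s n d a x k)"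

end

(* The empirical frequencies converge to the word probabilities by Birkhoff's ergodic theorem, so
   that for every word w of positive probability p_hat n a w + cf_hat n w a tends to p(a|w). Given
   the letters up to a visit of w, the next letter is a with probability at least p_-(a|w), so a
   Chernoff bound for an exponential supermartingale started at the first visit of w, with a union
   bound over the words, letters and numbers of visits and Borel-Cantelli, shows that almost surely,
   from some n on, p_-(a|w) <= p_hat n a w + cf_hat n w a for all w and a simultaneously (the
   constants of cf_hat leave enough room that no peeling is needed). Together, these give
   p_hat_minus n a w -> p_-(a|w) for every w of positive probability.

   The rest is deterministic. Put q_n(a|k) = p_hat_minus n a (x_{-k}, ..., x_{-1}). Then F_hat is
   min 1 (sum_a q_n(a|k)), and P_hat n a x >= q_n(a|k) - max 0 (sum_b q_n(b|k) - 1) for every k.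
   Letting n and then k tend to infinity, the lower limit of P_hat n a x is at least p(a|x); since
   both sum to 1 over a, this implies convergence in total variation. *)

theory Submission
  imports Defs "HOL-Real_Asymp.Real_Asymp"
begin

text \<open>The obstacle is uniformity over infinitely many words, most of them seen rarely or
  never. An upper bound on the minimum needs one extension close to the infimum, but a lower bound
  needs all extensions at once, and the number of words grows exponentially with their length.
  Charging a word for its possible first visits keeps the total cost polynomial in n. The bad event
  has probability of order exp (-3t/2), with t the value of \<open>t_star\<close>, and exp t >= |A|
  n^2 / delta. The surplus exp (-t/2) is at most 1/n and pays for the union over the number of
  visits, at each of which the Chernoff parameter is tuned afresh. The level \<open>h_hat\<close>
  moves with n, and no limit of it is established; hence the comparison of the predictor with a
  level k chosen before n, and in one direction only. The representation lives on its own
  probability space and is linked to the sample by the path law alone. The set of good pasts is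
  therefore built from the law of the past.\<close>

section \<open>Birkhoff's ergodic theorem in the ergodic case\<close>

text \<open>The largest of the Birkhoff sums of length 0, ..., \<open>n\<close> along the orbit of
  \<open>y\<close>; Garsia's proof of the maximal ergodic lemma rests on this recursion.\<close>

fun run_max :: "('b \<Rightarrow> 'b) \<Rightarrow> ('b \<Rightarrow> real) \<Rightarrow> nat \<Rightarrow> 'b \<Rightarrow> real" where
  "run_max T g 0 y = 0"
| "run_max T g (Suc n) y = max 0 (g y + run_max T g n (T y))"

lemma run_max_nonneg: "0 \<le> run_max T g n y"
  by (cases n) auto

lemma run_max_mono: "run_max T g n y \<le> run_max T g (Suc n) y"
proof (induction n arbitrary: y)
  case (Suc n)
  show ?case unfolding run_max.simps(2)[of T g n y] run_max.simps(2)[of T g "Suc n" y]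
    using Suc[of "T y"] by linarith
qed simp

lemma birkhoff_sum_Suc:
  fixes g :: "'b \<Rightarrow> real"
  shows "(\<Sum>i<Suc n. g ((T ^^ i) y)) = g y + (\<Sum>i<n. g ((T ^^ i) (T y)))"
  by (subst sum.lessThan_Suc_shift) (simp add: funpow_swap1)

lemma birkhoff_sum_le_run_max: "(\<Sum>i<n. g ((T ^^ i) y)) \<le> run_max T g n y"
proof (induction n arbitrary: y)
  case (Suc n)
  show ?case unfolding birkhoff_sum_Suc run_max.simps using Suc[of "T y"] by linarith
qed simp

section \<open>The maximal ergodic lemma\<close>

locale measure_preserving = prob_space P for P :: "'b measure" +
  fixes T :: "'b \<Rightarrow> 'b"
  assumes shift_measurable [measurable]: "T \<in> measurable P P"
    and shift_invariant: "distr P P T = P"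
begin

lemma integral_shift:
  fixes f :: "'b \<Rightarrow> real"
  assumes [measurable]: "f \<in> borel_measurable P"
  shows "(\<integral>y. f (T y) \<partial>P) = (\<integral>y. f y \<partial>P)"
  using integral_distr[of T P P f] by (simp add: shift_invariant)

lemma integrable_shift:
  fixes f :: "'b \<Rightarrow> real"
  assumes "integrable P f"
  shows "integrable P (\<lambda>y. f (T y))"
proof -
  have [measurable]: "f \<in> borel_measurable P" using assms by simp
  show ?thesis
    using integrable_distr_eq[of T P P f] assms by (simp add: shift_invariant)
qed

lemma integrable_run_max:
  assumes "integrable P g"
  shows "integrable P (run_max T g n)"
proof (induction n)
  case 0
  have "run_max T g 0 = (\<lambda>y. 0)" by auto
  then show ?case by simp
next
  case (Suc n)
  have "run_max T g (Suc n) = (\<lambda>y. max 0 (g y + run_max T g n (T y)))" by auto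
  then show ?case using integrable_shift[OF Suc] assms by simp
qed

text \<open>Garsia's argument: \<open>?r y - ?r (T y)\<close> integrates to 0 by invariance. Where
  \<open>?r\<close> is positive, the recursion and monotonicity in \<open>n\<close> bound this
  difference by \<open>g y\<close>; elsewhere it is at most 0.\<close>

lemma maximal_ergodic:
  assumes "integrable P g"
  shows "0 \<le> (\<integral>y. g y * indicator {y. 0 < run_max T g n y} y \<partial>P)"
proof (cases n)
  case (Suc m)
  let ?r = "run_max T g n"
  have ir: "integrable P ?r" by (rule integrable_run_max[OF assms])
  have [measurable]: "?r \<in> borel_measurable P" "g \<in> borel_measurable P" using ir assms by auto
  have i1: "integrable P (\<lambda>y. g y * indicator {y. 0 < ?r y} y)"
    by (rule Bochner_Integration.integrable_bound[OF assms]) (auto simp: indicator_def)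
  have "0 = (\<integral>y. ?r y - ?r (T y) \<partial>P)"
    using integral_shift[of ?r] ir integrable_shift[OF ir] by simp
  also have "\<dots> \<le> (\<integral>y. g y * indicator {y. 0 < ?r y} y \<partial>P)"
  proof (rule integral_mono)
    show "?r y - ?r (T y) \<le> g y * indicator {y. 0 < ?r y} y" for y
    proof (cases "0 < ?r y")
      case True
      then have "?r y = g y + run_max T g m (T y)" by (auto simp: Suc max_def split: if_splits)
      with run_max_mono[of T g m "T y"] True show ?thesis by (simp add: Suc del: run_max.simps)
    next
      case False
      with run_max_nonneg[of T g n y] run_max_nonneg[of T g n "T y"] show ?thesis by simp
    qed
  qed (use ir integrable_shift[OF ir] i1 in auto)
  finally show ?thesis .
qed simp

text \<open>The sets on which \<open>run_max\<close> is positive grow to almost the whole space, so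
  the maximal inequality passes to the limit by dominated convergence.\<close>

lemma integral_nonneg_if_birkhoff_sums_positive:
  fixes g :: "'b \<Rightarrow> real"
  assumes g: "integrable P g"
    and pos: "AE y in P. \<exists>n. 0 < (\<Sum>i<n. g ((T ^^ i) y))"
  shows "0 \<le> (\<integral>y. g y \<partial>P)"
proof -
  have [measurable]: "g \<in> borel_measurable P" "\<And>n. run_max T g n \<in> borel_measurable P"
    using g integrable_run_max[OF g] by auto
  have "(\<lambda>n. \<integral>y. g y * indicator {y. 0 < run_max T g n y} y \<partial>P) \<longlonglongrightarrow> (\<integral>y. g y \<partial>P)"
  proof (rule integral_dominated_convergence[where w = "\<lambda>y. \<bar>g y\<bar>"])
    show "AE y in P. (\<lambda>n. g y * indicator {y. 0 < run_max T g n y} y) \<longlonglongrightarrow> g y"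
      using pos
    proof (rule AE_mp, intro AE_I2 impI)
      fix y assume "\<exists>n. 0 < (\<Sum>i<n. g ((T ^^ i) y))"
      then obtain n0 where "0 < (\<Sum>i<n0. g ((T ^^ i) y))" by auto
      then have "0 < run_max T g n0 y" using birkhoff_sum_le_run_max[of g T y n0] by linarith
      moreover have "mono (\<lambda>n. run_max T g n y)" using run_max_mono by (intro incseq_SucI)
      ultimately have "\<And>n. n0 \<le> n \<Longrightarrow> 0 < run_max T g n y"
        by (meson less_le_trans monoD)
      then have "eventually (\<lambda>n. g y * indicator {y. 0 < run_max T g n y} y = g y) sequentially"
        unfolding eventually_sequentially by (intro exI[of _ n0]) auto
      then show "(\<lambda>n. g y * indicator {y. 0 < run_max T g n y} y) \<longlonglongrightarrow> g y"
        by (rule tendsto_eventually)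
    qed
  qed (use g in \<open>auto simp: indicator_def\<close>)
  then show ?thesis
    by (rule LIMSEQ_le_const) (auto intro: maximal_ergodic[OF g])
qed

end

section \<open>From the maximal lemma to pointwise convergence\<close>

locale ergodic_shift = measure_preserving P T for P :: "'b measure" and T +
  assumes shift_ergodic: "\<And>B. B \<in> sets P \<Longrightarrow> T -` B \<inter> space P = B \<Longrightarrow> prob B = 0 \<or> prob B = 1"
begin

text \<open>Unboundedness of the sums is shift-invariant, since the shift alters a sum only by the
  fixed amount \<open>g y\<close>; by ergodicity it has probability 0 or 1. Probability 1 would make
  some sum positive almost everywhere, and the integral nonnegative.\<close>

lemma birkhoff_sums_bounded_above:
  fixes g :: "'b \<Rightarrow> real"
  assumes g: "integrable P g" and neg: "(\<integral>y. g y \<partial>P) < 0"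
  shows "AE y in P. \<exists>C. \<forall>n. (\<Sum>i<n. g ((T ^^ i) y)) \<le> C"
proof -
  let ?S = "\<lambda>n y. \<Sum>i<n. g ((T ^^ i) y)"
  have [measurable]: "g \<in> borel_measurable P" using g by auto
  have [measurable]: "T ^^ i \<in> measurable P P" for i
    by (induction i) (auto simp: id_def intro!: measurable_comp[of _ P P T P])
  \<comment> \<open>Thresholds range over the naturals, so \<open>B\<close> is a countable
    combination of measurable sets.\<close>
  define B where "B = {y \<in> space P. \<forall>C::nat. \<exists>n. real C < ?S n y}"
  have B: "B \<in> sets P" unfolding B_def by measurable
  have TsP: "T y \<in> space P" if "y \<in> space P" for y
    using measurable_space[OF shift_measurable that] .
  have "y \<in> B" if "y \<in> space P" and Ty: "T y \<in> B" for y
  proof -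
    have "\<exists>n. real C < ?S n y" for C :: nat
    proof -
      obtain n where "real (C + nat \<lceil>\<bar>g y\<bar>\<rceil>) < ?S n (T y)" using Ty unfolding B_def by blast
      then have "real C < ?S (Suc n) y" unfolding birkhoff_sum_Suc by linarith
      then show ?thesis by blast
    qed
    then show ?thesis using that unfolding B_def by blast
  qed
  moreover have "T y \<in> B" if yB: "y \<in> B" for y
  proof -
    have "\<exists>n. real C < ?S n (T y)" for C :: nat
    proof -
      obtain n where n: "real (C + nat \<lceil>\<bar>g y\<bar>\<rceil>) < ?S n y" using yB unfolding B_def by blast
      then have "n \<noteq> 0" by (intro notI) (simp del: of_nat_add)
      then obtain m where m: "n = Suc m" using not0_implies_Suc by blast
      have "real C < ?S m (T y)" using n unfolding m birkhoff_sum_Suc by linarith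
      then show ?thesis by blast
    qed
    then show ?thesis using that TsP unfolding B_def by blast
  qed
  ultimately have "T -` B \<inter> space P = B" using sets.sets_into_space[OF B] by auto
  then consider "prob B = 0" | "prob B = 1" using shift_ergodic B by blast
  then show ?thesis
  proof cases
    case 1
    then have "AE y in P. y \<notin> B" using B by (simp add: prob_eq_0)
    then show ?thesis
      by (rule AE_mp, intro AE_I2 impI) (auto simp: B_def not_less)
  next
    case 2
    then have "AE y in P. y \<in> B" using B by (simp add: AE_in_set_eq_1)
    then have "AE y in P. \<exists>n. 0 < ?S n y"
    proof (rule AE_mp, intro AE_I2 impI)
      fix y assume "y \<in> B"
      then have "\<exists>n. real 0 < ?S n y" unfolding B_def by blast
      then show "\<exists>n. 0 < ?S n y" by simp
    qed
    from integral_nonneg_if_birkhoff_sums_positive[OF g this] neg show ?thesis by simp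
  qed
qed

lemma birkhoff_averages_eventually_le:
  fixes f :: "'b \<Rightarrow> real"
  assumes f: "integrable P f"
  shows "AE y in P. \<forall>e>0. eventually (\<lambda>n. (\<Sum>i<n. f ((T ^^ i) y)) / real n \<le> (\<integral>y. f y \<partial>P) + e) sequentially"
proof -
  \<comment> \<open>Subtracting slightly more than the mean makes the integral negative, and bounded
    sums divided by \<open>n\<close> vanish. The slack runs through a sequence, so one null set
    serves every \<open>e\<close>.\<close>
  let ?c = "\<lambda>k. (\<integral>y. f y \<partial>P) + 1 / real (Suc k)"
  have "AE y in P. \<exists>C. \<forall>n. (\<Sum>i<n. f ((T ^^ i) y) - ?c k) \<le> C" for k
    by (rule birkhoff_sums_bounded_above) (use f in \<open>auto simp: prob_space\<close>)
  then have "AE y in P. \<forall>k. \<exists>C. \<forall>n. (\<Sum>i<n. f ((T ^^ i) y) - ?c k) \<le> C"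
    by (simp add: AE_all_countable)
  then show ?thesis
  proof (rule AE_mp, intro AE_I2 impI allI)
    fix y and e :: real
    assume bd: "\<forall>k. \<exists>C. \<forall>n. (\<Sum>i<n. f ((T ^^ i) y) - ?c k) \<le> C" and e: "0 < e"
    obtain k where k: "1 / real (Suc k) < e / 2"
      using reals_Archimedean[of "e/2"] e by (auto simp: inverse_eq_divide)
    obtain C where C: "\<And>n. (\<Sum>i<n. f ((T ^^ i) y) - ?c k) \<le> C" using bd by blast
    have "(\<lambda>n. C / real n) \<longlonglongrightarrow> 0" by (rule lim_const_over_n)
    then have "eventually (\<lambda>n. C / real n < e / 2) sequentially"
      using e by (intro order_tendstoD) auto
    then show "eventually (\<lambda>n. (\<Sum>i<n. f ((T ^^ i) y)) / real n \<le> (\<integral>y. f y \<partial>P) + e) sequentially"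
      using eventually_gt_at_top[of 0]
    proof eventually_elim
      case (elim n)
      have "(\<Sum>i<n. f ((T ^^ i) y)) \<le> C + real n * ?c k" using C[of n] by (simp add: sum_subtractf)
      then have "(\<Sum>i<n. f ((T ^^ i) y)) / real n \<le> C / real n + ?c k"
        using elim(2) by (simp add: divide_le_eq distrib_left mult.commute)
      with elim(1) k show ?case by linarith
    qed
  qed
qed

theorem birkhoff:
  fixes f :: "'b \<Rightarrow> real"
  assumes f: "integrable P f"
  shows "AE y in P. (\<lambda>n. (\<Sum>i<n. f ((T ^^ i) y)) / real n) \<longlonglongrightarrow> (\<integral>y. f y \<partial>P)"
proof -
  let ?A = "\<lambda>n y. (\<Sum>i<n. f ((T ^^ i) y)) / real n"
  have "AE y in P. \<forall>e>0. eventually (\<lambda>n. - ?A n y \<le> - (\<integral>y. f y \<partial>P) + e) sequentially"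
    using birkhoff_averages_eventually_le[of "\<lambda>y. - f y"] f
    by (simp add: sum_negf)
  with birkhoff_averages_eventually_le[OF f] show ?thesis
  proof (rule AE_mp[OF _ AE_mp], intro AE_I2 impI)
    fix y
    assume up: "\<forall>e>0. eventually (\<lambda>n. ?A n y \<le> (\<integral>y. f y \<partial>P) + e) sequentially"
      and lo: "\<forall>e>0. eventually (\<lambda>n. - ?A n y \<le> - (\<integral>y. f y \<partial>P) + e) sequentially"
    show "(\<lambda>n. ?A n y) \<longlonglongrightarrow> (\<integral>y. f y \<partial>P)"
    proof (rule tendstoI)
      fix e :: real assume "0 < e"
      then have "0 < e / 2" by simp
      with up lo have "eventually (\<lambda>n. ?A n y \<le> (\<integral>y. f y \<partial>P) + e / 2) sequentially"
        "eventually (\<lambda>n. - ?A n y \<le> - (\<integral>y. f y \<partial>P) + e / 2) sequentially" by blast+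
      then show "eventually (\<lambda>n. dist (?A n y) (\<integral>y. f y \<partial>P) < e) sequentially"
        by eventually_elim (use \<open>0 < e\<close> in \<open>auto simp: dist_real_def abs_less_iff\<close>)
    qed
  qed
qed

end

section \<open>Concentration, uniformly over words\<close>

definition words :: "nat \<Rightarrow> 'a list set" where
  "words n = {u. length u = n}"

lemma finite_words [simp]: "finite (words n :: 'a::finite list set)"
  unfolding words_def using finite_lists_length_eq[of "UNIV :: 'a set" n] by simp

lemma words_0 [simp]: "words 0 = {[]}"
  by (auto simp: words_def)

lemma sum_words_Suc:
  fixes g :: "'a::finite list \<Rightarrow> 'b::comm_monoid_add"
  shows "(\<Sum>u\<in>words (Suc n). g u) = (\<Sum>u\<in>words n. \<Sum>b\<in>UNIV. g (u @ [b]))"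
proof -
  have "bij_betw (\<lambda>(u, b). u @ [b]) (words n \<times> UNIV) (words (Suc n) :: 'a list set)"
    by (rule bij_betwI[where g = "\<lambda>u. (butlast u, last u)"]) (auto simp: words_def simp flip: length_greater_0_conv)
  from sum.reindex_bij_betw[OF this, of g] show ?thesis
    by (simp add: sum.cartesian_product case_prod_beta)
qed

text \<open>Only proper prefixes count, so each visit is followed by a letter of \<open>u\<close>.
  On a sample of length n > 0 this is N_{n-1}(w), and \<open>hits\<close> is N_n(wa).\<close>

definition visits :: "'a list \<Rightarrow> 'a list \<Rightarrow> nat" where
  "visits w u = (\<Sum>i<length u. of_bool (suffix w (take i u)))"

definition hits :: "'a list \<Rightarrow> 'a \<Rightarrow> 'a list \<Rightarrow> nat" where
  "hits w a u = (\<Sum>i<length u. of_bool (suffix w (take i u) \<and> u ! i = a))"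

lemma visits_snoc: "visits w (u @ [b]) = visits w u + of_bool (suffix w u)"
  by (simp add: visits_def)

lemma hits_snoc: "hits w a (u @ [b]) = hits w a u + of_bool (suffix w u \<and> b = a)"
proof -
  have "(\<Sum>i<length u. of_bool (suffix w (take i u) \<and> (u @ [b]) ! i = a) :: nat) = hits w a u"
    unfolding hits_def by (intro sum.cong) (auto simp: nth_append)
  then show ?thesis by (simp add: hits_def)
qed

lemma hits_le_visits: "hits w a u \<le> visits w u"
  unfolding hits_def visits_def by (intro sum_mono) auto

lemma visits_le_length: "visits w u \<le> length u"
proof -
  have "visits w u \<le> (\<Sum>i<length u. 1)" unfolding visits_def by (intro sum_mono) auto
  then show ?thesis by simp
qed

lemma length_less_if_visits_pos:
  assumes "0 < visits w u"
  shows "length w < length u"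
proof -
  have "\<exists>i<length u. suffix w (take i u)"
    using assms by (rule contrapos_pp) (auto simp: visits_def)
  then obtain i where "i < length u" "suffix w (take i u)" by blast
  then show ?thesis using suffix_length_le[of w "take i u"] by auto
qed

text \<open>Since 2 + sqrt 2 >= 3, \<open>d = r - s\<close> is at least 2 sqrt (s t) + 3t, whence
  d^2 >= 3 t r. So y = sqrt (3t/r) satisfies y r <= r - s, and with exp (-y) <= 1 - y + y^2/2 there
  remains at least y^2 r / 2 = 3t/2.\<close>

lemma chernoff_exponent:
  fixes s r t :: real
  assumes s: "0 \<le> s" and t: "0 < t" and bad: "s + 2 * sqrt (s * t) + (2 + sqrt 2) * t < r"
  shows "3 * t / 2 \<le> (1 - exp (- sqrt (3 * t / r))) * r - sqrt (3 * t / r) * s"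
proof -
  define d where "d = r - s"
  have sq: "0 \<le> sqrt (s * t)" using s t by simp
  have "1 \<le> sqrt 2" by simp
  then have "t * 1 \<le> t * sqrt 2" using t by (intro mult_left_mono) auto
  then have d: "2 * sqrt (s * t) + 3 * t \<le> d" using bad by (simp add: d_def algebra_simps)
  then have r: "0 < r" and d0: "0 \<le> d" using sq t s unfolding d_def by linarith+
  \<comment> \<open>The product of the bounds on \<open>d\<close> and \<open>d - 3 * t\<close>
    contains 4 s t, which gives d^2 >= 3t (d + s), and d + s is \<open>r\<close>.\<close>
  have "(2 * sqrt (s * t) + 3 * t) * (2 * sqrt (s * t)) \<le> d * (d - 3 * t)"
    using d sq t d0 by (intro mult_mono) auto
  moreover have "(2 * sqrt (s * t) + 3 * t) * (2 * sqrt (s * t)) = 4 * (s * t) + 6 * t * sqrt (s * t)"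
    using s t by (simp add: algebra_simps)
  moreover have "0 \<le> 6 * t * sqrt (s * t)" using sq t by simp
  moreover have "0 \<le> s * t" using s t by simp
  ultimately have "3 * t * r \<le> d\<^sup>2"
    by (simp add: d_def power2_eq_square algebra_simps)
  then have dr: "sqrt (3 * t * r) \<le> d" using d0 real_le_lsqrt by blast
  define y where "y = sqrt (3 * t / r)"
  have y: "0 \<le> y" "y\<^sup>2 * r = 3 * t" using r t by (simp_all add: y_def)
  have "y * r = sqrt (3 * t * r)"
    using r t by (simp add: y_def real_sqrt_divide real_sqrt_mult real_div_sqrt field_simps)
  then have ys: "y * r \<le> r - s" using dr by (simp add: d_def)
  have "exp (- y) \<le> 1 - y + y\<^sup>2 / 2"
  proof -
    \<comment> \<open>The Lagrange remainder of order 3 is nonpositive at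
      \<open>- y\<close>.\<close>
    have "\<exists>z. \<bar>z\<bar> \<le> \<bar>- y\<bar> \<and> exp (- y) = (\<Sum>m<3. (- y) ^ m / fact m) + exp z / fact 3 * (- y) ^ 3"
      using Maclaurin_exp_le[of "- y" 3] by blast
    then obtain z where "exp (- y) = (\<Sum>m<3. (- y) ^ m / fact m) + exp z / fact 3 * (- y) ^ 3" by blast
    moreover have "0 \<le> exp z / fact 3 * y ^ 3" using y by simp
    ultimately show ?thesis by (simp add: eval_nat_numeral)
  qed
  then have "(y - y\<^sup>2 / 2) * r \<le> (1 - exp (- y)) * r" using r by (intro mult_right_mono) auto
  moreover have "y * s \<le> y * (r - y * r)" using ys y by (intro mult_left_mono) auto
  ultimately have "y\<^sup>2 * r / 2 \<le> (1 - exp (- y)) * r - y * s"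
    by (simp add: algebra_simps power2_eq_square)
  then show ?thesis using y(2) by (simp add: y_def)
qed

text \<open>Concentration is a matter of word probabilities: expectations over a sample are finite
  sums over \<open>words n\<close>, and conditioning on the past is the sum over the last letter in
  \<open>snoc\<close>.\<close>

locale word_law =
  fixes \<mu> :: "'a::finite list \<Rightarrow> real"
  assumes nonneg: "0 \<le> \<mu> u"
    and Nil: "\<mu> [] = 1"
    and snoc: "(\<Sum>b\<in>UNIV. \<mu> (u @ [b])) = \<mu> u"
begin

lemma sum_words: "(\<Sum>u\<in>words n. \<mu> u) = 1"
  by (induction n) (simp_all add: Nil snoc sum_words_Suc)

definition ending :: "'a list \<Rightarrow> nat \<Rightarrow> real" where
  "ending w i = (\<Sum>u\<in>words i. of_bool (suffix w u) * \<mu> u)"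

text \<open>A word has at most one suffix of each length, so for fixed \<open>l\<close> and
  \<open>i\<close> the events behind \<open>ending\<close> are disjoint.\<close>

lemma sum_ending_le_1: "(\<Sum>w\<in>words l. ending w i) \<le> 1"
proof -
  have "(\<Sum>w\<in>words l. of_bool (suffix w u)) \<le> (1::real)" for u :: "'a list"
  proof -
    have "w = drop (length u - l) u" if "w \<in> words l" "suffix w u" for w
      using that by (auto simp: words_def suffix_def)
    then have "{w \<in> words l. suffix w u} \<subseteq> {drop (length u - l) u}" by blast
    then have "card {w \<in> words l. suffix w u} \<le> 1" by (simp add: card_mono[of "{_}", simplified])
    then show ?thesis by (simp add: sum_of_bool_eq Int_def)
  qed
  then have "(\<Sum>u\<in>words i. (\<Sum>w\<in>words l. of_bool (suffix w u)) * \<mu> u) \<le> (\<Sum>u\<in>words i. 1 * \<mu> u)"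
    by (intro sum_mono mult_right_mono nonneg)
  moreover have "(\<Sum>w\<in>words l. ending w i)
      = (\<Sum>u\<in>words i. (\<Sum>w\<in>words l. of_bool (suffix w u)) * \<mu> u)"
    unfolding ending_def by (subst sum.swap) (simp add: sum_distrib_right)
  ultimately show ?thesis by (simp add: sum_words)
qed

text \<open>The exponential weight is 1 until the first visit of \<open>w\<close> and does not increase in mean
  afterwards. Bounding by the position of the first visit, instead of by 1, is what makes the sum
  over all words \<open>w\<close> affordable, by \<open>sum_ending_le_1\<close>.\<close>

lemma exponential_moment:
  fixes l p :: real
  defines "c \<equiv> 1 - exp (- l)"
  assumes l: "0 \<le> l" and p: "\<And>u. suffix w u \<Longrightarrow> p * \<mu> u \<le> \<mu> (u @ [a])"
  shows "(\<Sum>u\<in>words n. of_bool (0 < visits w u)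
             * exp (c * p * real (visits w u) - l * real (hits w a u)) * \<mu> u)
         \<le> (\<Sum>i<n. ending w i)"
proof (induction n)
  case 0
  show ?case by (simp add: visits_def)
next
  case (Suc n)
  define e where "e u = exp (c * p * real (visits w u) - l * real (hits w a u))" for u
  have c: "0 \<le> c" using l by (simp add: c_def)
  have step: "(\<Sum>b\<in>UNIV. of_bool (0 < visits w (u @ [b])) * e (u @ [b]) * \<mu> (u @ [b]))
      \<le> of_bool (0 < visits w u) * e u * \<mu> u + of_bool (suffix w u) * \<mu> u" for u
  proof (cases "suffix w u")
    case False
    then show ?thesis
      by (simp add: e_def visits_snoc hits_snoc flip: sum_distrib_left snoc[of u])
  next
    case True
    \<comment> \<open>Apart from the factor \<open>exp (c * p)\<close> of the visit, the letter
      \<open>a\<close> multiplies the weight by \<open>exp (- l) = 1 - c\<close> and any other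
      letter by 1.\<close>
    have "(\<Sum>b\<in>UNIV. exp (- l * of_bool (b = a)) * \<mu> (u @ [b]))
        = (\<Sum>b\<in>UNIV. \<mu> (u @ [b]) - of_bool (b = a) * (c * \<mu> (u @ [a])))"
      by (intro sum.cong) (auto simp: c_def algebra_simps)
    also have "\<dots> = \<mu> u - c * \<mu> (u @ [a])"
      by (simp add: sum_subtractf snoc flip: sum_distrib_right)
    also have "\<dots> \<le> (1 + - (c * p)) * \<mu> u"
      using mult_left_mono[OF p[OF True] c] by (simp add: algebra_simps)
    also have "\<dots> \<le> exp (- (c * p)) * \<mu> u"
      by (intro mult_right_mono exp_ge_add_one_self nonneg)
    finally have *: "exp (c * p) * (\<Sum>b\<in>UNIV. exp (- l * of_bool (b = a)) * \<mu> (u @ [b])) \<le> \<mu> u"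
      by (simp add: exp_minus divide_simps mult.commute)
    have "(\<Sum>b\<in>UNIV. of_bool (0 < visits w (u @ [b])) * e (u @ [b]) * \<mu> (u @ [b]))
        = e u * (exp (c * p) * (\<Sum>b\<in>UNIV. exp (- l * of_bool (b = a)) * \<mu> (u @ [b])))"
      unfolding sum_distrib_left
      by (intro sum.cong)
         (use True in \<open>auto simp: e_def visits_snoc hits_snoc algebra_simps simp flip: exp_add\<close>)
    also have "\<dots> \<le> e u * \<mu> u"
      by (intro mult_left_mono *) (simp add: e_def)
    \<comment> \<open>Before the first visit \<open>e u\<close> is 1 and the indicator is 0; a first
      visit is charged to the term of \<open>ending\<close>.\<close>
    also have "\<dots> \<le> of_bool (0 < visits w u) * e u * \<mu> u + of_bool (suffix w u) * \<mu> u"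
      using True hits_le_visits[of w a u] nonneg[of u] by (cases "visits w u = 0") (auto simp: e_def)
    finally show ?thesis .
  qed
  have "(\<Sum>u\<in>words (Suc n). of_bool (0 < visits w u) * e u * \<mu> u)
      \<le> (\<Sum>u\<in>words n. of_bool (0 < visits w u) * e u * \<mu> u) + ending w n"
    unfolding sum_words_Suc ending_def sum.distrib[symmetric] by (intro sum_mono step)
  then show ?case using Suc unfolding e_def by simp
qed

text \<open>Markov's inequality for the exponential weight, which is at least
  \<open>exp (3 * t / 2)\<close> on the bad event. The number of visits is fixed at \<open>m\<close>
  because the rate \<open>l\<close> required by \<open>chernoff_exponent\<close> depends on
  it.\<close>

lemma lower_tail:
  fixes p t :: real
  assumes t: "0 < t" and p: "\<And>u. suffix w u \<Longrightarrow> p * \<mu> u \<le> \<mu> (u @ [a])" and m: "0 < m"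
  shows "(\<Sum>u\<in>words n. of_bool (visits w u = m \<and>
             real (hits w a u) + 2 * sqrt (real (hits w a u) * t) + (2 + sqrt 2) * t < p * real m) * \<mu> u)
         \<le> exp (- (3 * t / 2)) * (\<Sum>i<n. ending w i)"
proof (cases "0 \<le> p")
  case True
  define l where "l = sqrt (3 * t / (p * real m))"
  define E where "E = (\<lambda>u. exp ((1 - exp (- l)) * p * real (visits w u) - l * real (hits w a u)))"
  define B where "B = (\<lambda>u. visits w u = m \<and>
     real (hits w a u) + 2 * sqrt (real (hits w a u) * t) + (2 + sqrt 2) * t < p * real m)"
  have E0: "0 \<le> E u" for u by (simp add: E_def)
  have "of_bool (B u) \<le> exp (- (3 * t / 2)) * (of_bool (0 < visits w u) * E u)" for u
  proof (cases "B u")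
    case True
    then have "3 * t / 2 \<le> (1 - exp (- l)) * p * real (visits w u) - l * real (hits w a u)"
      using chernoff_exponent[of "real (hits w a u)" t "p * real m"] t
      by (simp add: B_def l_def mult.assoc)
    then have "exp (3 * t / 2) \<le> E u" by (simp add: E_def)
    then have "exp (- (3 * t / 2)) * exp (3 * t / 2) \<le> exp (- (3 * t / 2)) * E u" by simp
    then show ?thesis using True m by (simp add: B_def flip: exp_add)
  qed (use E0 in simp)
  then have "(\<Sum>u\<in>words n. of_bool (B u) * \<mu> u)
      \<le> (\<Sum>u\<in>words n. exp (- (3 * t / 2)) * (of_bool (0 < visits w u) * E u) * \<mu> u)"
    by (intro sum_mono mult_right_mono nonneg)
  also have "\<dots> = exp (- (3 * t / 2)) * (\<Sum>u\<in>words n. of_bool (0 < visits w u) * E u * \<mu> u)"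
    unfolding sum_distrib_left mult.assoc ..
  also have "\<dots> \<le> exp (- (3 * t / 2)) * (\<Sum>i<n. ending w i)"
    unfolding E_def using p True t by (intro mult_left_mono exponential_moment) (auto simp: l_def)
  finally show ?thesis unfolding B_def .
next
  case False
  then have "p * real m \<le> 0" by (simp add: mult_nonpos_nonneg)
  moreover have "0 \<le> real (hits w a u) + 2 * sqrt (real (hits w a u) * t) + (2 + sqrt 2) * t" for u
    using t by simp
  ultimately have "\<not> real (hits w a u) + 2 * sqrt (real (hits w a u) * t) + (2 + sqrt 2) * t < p * real m" for u
    using le_less_trans not_less order_trans by metis
  moreover have "0 \<le> ending w i" for i unfolding ending_def by (intro sum_nonneg) (simp add: nonneg)
  ultimately show ?thesis by (simp add: sum_nonneg)
qed

text \<open>Of the three factors \<open>n\<close>, one counts the number of visits, one the length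
  of the word and one the position of the first visit. Summing over the words of one length costs
  nothing more, by \<open>sum_ending_le_1\<close>.\<close>

lemma uniform_lower_tail:
  fixes p :: "'a \<Rightarrow> 'a list \<Rightarrow> real" and t :: real
  assumes t: "0 < t" and p: "\<And>a w u. suffix w u \<Longrightarrow> p a w * \<mu> u \<le> \<mu> (u @ [a])"
  shows "(\<Sum>u\<in>words n. of_bool (\<exists>w a. 0 < visits w u \<and>
             real (hits w a u) + 2 * sqrt (real (hits w a u) * t) + (2 + sqrt 2) * t
               < p a w * real (visits w u)) * \<mu> u)
         \<le> real CARD('a) * real n ^ 3 * exp (- (3 * t / 2))"
proof -
  define B where "B = (\<lambda>m w a u. visits w u = m \<and>
     real (hits w a u) + 2 * sqrt (real (hits w a u) * t) + (2 + sqrt 2) * t < p a w * real m)"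
  \<comment> \<open>A visited word is shorter than the sample, so finitely many indices cover all
    \<open>w\<close>.\<close>
  define I where "I = {1..n} \<times> (UNIV :: 'a set) \<times> (SIGMA l:{..<n}. (words l :: 'a list set))"
  have fin: "finite I" unfolding I_def by auto
  let ?b = "\<lambda>(m, a, l, w) u. B m w a u"
  have "(\<Sum>u\<in>words n. of_bool (\<exists>w a. 0 < visits w u \<and>
             real (hits w a u) + 2 * sqrt (real (hits w a u) * t) + (2 + sqrt 2) * t
               < p a w * real (visits w u)) * \<mu> u)
      \<le> (\<Sum>u\<in>words n. (\<Sum>i\<in>I. of_bool (?b i u)) * \<mu> u)"
  proof (intro sum_mono mult_right_mono nonneg)
    fix u :: "'a list" assume u: "u \<in> words n"
    show "of_bool (\<exists>w a. 0 < visits w u \<and>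
             real (hits w a u) + 2 * sqrt (real (hits w a u) * t) + (2 + sqrt 2) * t
               < p a w * real (visits w u)) \<le> (\<Sum>i\<in>I. of_bool (?b i u) :: real)" (is "of_bool ?ex \<le> _")
    proof (cases ?ex)
      case True
      then obtain w a where wa: "0 < visits w u" "B (visits w u) w a u" by (auto simp: B_def)
      then have "(visits w u, a, length w, w) \<in> I"
        using u length_less_if_visits_pos[OF wa(1)] visits_le_length[of w u]
        by (auto simp: I_def words_def)
      then have "of_bool (?b (visits w u, a, length w, w) u) \<le> (\<Sum>i\<in>I. of_bool (?b i u) :: real)"
        by (intro member_le_sum fin) auto
      then show ?thesis using True wa by simp
    next
      case False
      then show ?thesis by (simp only: of_bool_eq sum_nonneg of_bool_def if_False) (simp add: sum_nonneg)
    qed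
  qed
  also have "\<dots> = (\<Sum>i\<in>I. \<Sum>u\<in>words n. of_bool (?b i u) * \<mu> u)"
    unfolding sum_distrib_right by (rule sum.swap)
  also have "\<dots> \<le> (\<Sum>i\<in>I. exp (- (3 * t / 2)) * (\<Sum>j<n. ending (snd (snd (snd i))) j))"
  proof (intro sum_mono, clarify)
    fix m a l w assume "(m, a, l, w) \<in> I"
    then have "0 < m" by (auto simp: I_def)
    then show "(\<Sum>u\<in>words n. of_bool (B m w a u) * \<mu> u)
        \<le> exp (- (3 * t / 2)) * (\<Sum>j<n. ending (snd (snd (snd (m, a, l, w)))) j)"
      using lower_tail[of t w "p a w" a m n] t p unfolding B_def by simp
  qed
  also have "\<dots> = exp (- (3 * t / 2)) * (\<Sum>m\<in>{1..n}. \<Sum>a\<in>(UNIV::'a set). \<Sum>l<n. \<Sum>w\<in>words l. \<Sum>j<n. ending w j)"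
    unfolding I_def sum_distrib_left[symmetric] sum.cartesian_product' snd_conv
    by (intro arg_cong2[where f = times] sum.cong refl, subst sum.Sigma) (auto simp: split_beta)
  also have "(\<Sum>m\<in>{1..n}. \<Sum>a\<in>(UNIV::'a set). \<Sum>l<n. \<Sum>w\<in>words l. \<Sum>j<n. ending w j)
      = (\<Sum>m\<in>{1..n}. \<Sum>a\<in>(UNIV::'a set). \<Sum>l<n. \<Sum>j<n. \<Sum>w\<in>words l. ending w j)"
    by (intro sum.cong refl sum.swap)
  also have "\<dots> \<le> (\<Sum>m\<in>{1..n}. \<Sum>a\<in>(UNIV::'a set). \<Sum>l<n. \<Sum>j<n. 1)"
    by (intro sum_mono sum_ending_le_1)
  finally show ?thesis
    by (simp add: power3_eq_cube mult_ac)
qed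

end

section \<open>Word probabilities and frequencies\<close>

lemma length_block [simp]: "length (block y i j) = nat (j - i + 1)"
  by (simp add: block_def)

lemma block_cong: "(\<And>n. i \<le> n \<Longrightarrow> n \<le> j \<Longrightarrow> y n = z n) \<Longrightarrow> block y i j = block z i j"
  by (simp add: block_def)

lemma block_shift: "block (\<lambda>n. y (n + m)) i j = block y (i + m) (j + m)"
  unfolding block_def by (rule nth_equalityI) (auto simp: nth_upto algebra_simps)

lemma block_snoc: "i \<le> j + 1 \<Longrightarrow> block y i (j + 1) = block y i j @ [y (j + 1)]"
  by (simp add: block_def upto_rec2)

lemma drop_block: "drop m (block y i j) = block y (i + int m) j"
  unfolding block_def by (rule nth_equalityI) (auto simp: nth_upto algebra_simps)

lemma take_block: "take m (block y 1 (int n)) = block y 1 (int (min m n))"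
  unfolding block_def by (rule nth_equalityI) (auto simp: nth_upto algebra_simps)

lemma nth_block: "m < n \<Longrightarrow> block y 1 (int n) ! m = y (int m + 1)"
  unfolding block_def by (simp add: nth_upto add.commute)

lemma suffix_block_iff:
  "suffix w (block s 1 (int i)) \<longleftrightarrow>
     length w \<le> i \<and> block s (int i - int (length w) + 1) (int i) = w"
proof -
  have "suffix w u \<longleftrightarrow> length w \<le> length u \<and> drop (length u - length w) u = w" for u
    by (metis suffix_drop suffix_length_le append_eq_conv_conj suffix_def length_append add_diff_cancel_right')
  then show ?thesis by (auto simp: drop_block of_nat_diff algebra_simps)
qed

lemma occ_conv_suffix: "occ s j w = card {i. i \<le> j \<and> suffix w (block s 1 (int i))}"
  unfolding occ_def suffix_block_iff by (rule arg_cong[where f = card]) auto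

lemma visits_block:
  assumes "0 < n"
  shows "visits w (block s 1 (int n)) = occ s (n - 1) w"
proof -
  have "visits w (block s 1 (int n)) = (\<Sum>i<n. of_bool (suffix w (block s 1 (int i))))"
    unfolding visits_def by (intro sum.cong) (auto simp: take_block)
  also have "\<dots> = card ({..<n} \<inter> {i. suffix w (block s 1 (int i))})"
    by simp
  also have "{..<n} \<inter> {i. suffix w (block s 1 (int i))} = {i. i \<le> n - 1 \<and> suffix w (block s 1 (int i))}"
    using assms by auto
  finally show ?thesis by (simp add: occ_conv_suffix)
qed

lemma hits_block: "hits w a (block s 1 (int n)) = occ s n (w @ [a])"
proof -
  have suffix_iff: "suffix (w @ [a]) (block s 1 (int (Suc i))) \<longleftrightarrow>
      suffix w (block s 1 (int i)) \<and> s (int i + 1) = a" for i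
    using block_snoc[of 1 "int i" s] by (auto simp: snoc_suffix_snoc add.commute)
  have "hits w a (block s 1 (int n))
      = (\<Sum>i<n. of_bool (suffix w (block s 1 (int i)) \<and> s (int i + 1) = a))"
    unfolding hits_def by (intro sum.cong) (auto simp: take_block nth_block)
  also have "\<dots> = card ({..<n} \<inter> {i. suffix w (block s 1 (int i)) \<and> s (int i + 1) = a})"
    by simp
  also have "\<dots> = card (Suc ` ({..<n} \<inter> {i. suffix w (block s 1 (int i)) \<and> s (int i + 1) = a}))"
    by (simp add: card_image)
  also have "Suc ` ({..<n} \<inter> {i. suffix w (block s 1 (int i)) \<and> s (int i + 1) = a})
      = {i. i \<le> n \<and> suffix (w @ [a]) (block s 1 (int i))}"
  proof (intro set_eqI)
    fix i
    show "i \<in> Suc ` ({..<n} \<inter> {i. suffix w (block s 1 (int i)) \<and> s (int i + 1) = a})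
        \<longleftrightarrow> i \<in> {i. i \<le> n \<and> suffix (w @ [a]) (block s 1 (int i))}"
    proof (cases i)
      case 0
      then show ?thesis by (simp add: block_def)
    next
      case (Suc m)
      then show ?thesis using suffix_iff[of m] by auto
    qed
  qed
  finally show ?thesis by (simp add: occ_conv_suffix)
qed

text \<open>Counting occurrences by their start instead of their end gives a Birkhoff sum of a
  cylinder indicator under the shift. Truncated subtraction covers \<open>j\<close> below the length
  of \<open>w\<close>.\<close>

lemma occ_conv_sum:
  "real (occ s j w) = (\<Sum>i<j + 1 - length w. indicator {y. block y 1 (int (length w)) = w} (\<lambda>n. s (n + int i)))"
proof -
  let ?L = "length w"
  have "(\<Sum>i<j + 1 - ?L. indicator {y. block y 1 (int ?L) = w} (\<lambda>n. s (n + int i)))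
      = real (card ({..<j + 1 - ?L} \<inter> {i. block s (1 + int i) (int ?L + int i) = w}))"
    by (simp add: indicator_def block_shift of_bool_def[symmetric])
  also have "\<dots> = real (card ((\<lambda>i. i + ?L) ` ({..<j + 1 - ?L} \<inter> {i. block s (1 + int i) (int ?L + int i) = w})))"
    by (simp add: card_image)
  also have "(\<lambda>i. i + ?L) ` ({..<j + 1 - ?L} \<inter> {i. block s (1 + int i) (int ?L + int i) = w})
      = {i. ?L \<le> i \<and> i \<le> j \<and> block s (int i - int ?L + 1) (int i) = w}" (is "?A = ?B")
  proof
    show "?B \<subseteq> ?A"
    proof
      fix i assume "i \<in> ?B"
      then show "i \<in> ?A" by (intro image_eqI[of _ _ "i - ?L"]) (auto simp: algebra_simps of_nat_diff)
    qed
  qed (auto simp: algebra_simps)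
  finally show ?thesis by (simp add: occ_def)
qed

section \<open>Measurability of words read off a path\<close>

lemma measurable_map_list:
  fixes f :: "'i \<Rightarrow> 'b \<Rightarrow> 's::countable"
  assumes "\<And>i. i \<in> set is \<Longrightarrow> f i \<in> measurable M (count_space UNIV)"
  shows "(\<lambda>y. map (\<lambda>i. f i y) is) \<in> measurable M (count_space UNIV)"
  using assms
proof (induction "is")
  case (Cons i "is")
  then have [measurable]: "f i \<in> measurable M (count_space UNIV)"
    "(\<lambda>y. map (\<lambda>i. f i y) is) \<in> measurable M (count_space UNIV)" by auto
  show ?case by simp
qed simp

lemma measurable_block_component:
  assumes "{i..j} \<subseteq> I"
  shows "(\<lambda>y. block y i j) \<in> measurable (\<Pi>\<^sub>M i\<in>I. count_space (UNIV :: 's::countable set)) (count_space UNIV)"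
  unfolding block_def
  by (rule measurable_map_list) (use assms in \<open>auto intro!: measurable_component_singleton\<close>)

lemma measurable_suffix_of_past [measurable]:
  "(\<lambda>x. suffix_of_past x k) \<in> measurable (past_space :: (int \<Rightarrow> 's::countable) measure) (count_space UNIV)"
  unfolding suffix_of_past_def past_space_def by (rule measurable_block_component) auto

section \<open>Finite-dimensional laws of a stationary process\<close>

locale stationary_process =
  fixes M :: "'w measure" and X :: "int \<Rightarrow> 'w \<Rightarrow> 'a::finite"
  assumes stationary: "stationary M X"
begin

sublocale prob_space M
  using stationary by (simp add: stationary_def process_def)

abbreviation path :: "'w \<Rightarrow> int \<Rightarrow> 'a" where "path \<omega> \<equiv> (\<lambda>n. X n \<omega>)"

lemma X_measurable [measurable]: "X n \<in> measurable M (count_space UNIV)"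
  using stationary by (simp add: stationary_def process_def)

lemma path_measurable: "path \<in> measurable M (\<Pi>\<^sub>M i\<in>UNIV. count_space UNIV)"
  by (rule measurable_PiM_single') auto

lemma block_measurable [measurable]:
  "(\<lambda>\<omega>. block (path \<omega>) i j) \<in> measurable M (count_space UNIV)"
  unfolding block_def by (rule measurable_map_list) simp

lemma suffix_measurable [measurable]:
  "(\<lambda>\<omega>. suffix_of_past (path \<omega>) k) \<in> measurable M (count_space UNIV)"
  unfolding suffix_of_past_def by simp

definition word_prob :: "'a list \<Rightarrow> real" where
  "word_prob w = \<P>(\<omega> in M. suffix_of_past (path \<omega>) (length w) = w)"

lemma measure_path_law:
  assumes "B \<in> sets (\<Pi>\<^sub>M i\<in>UNIV. count_space UNIV)"
  shows "measure (path_law M (\<lambda>n. X (n + m))) B = \<P>(\<omega> in M. (\<lambda>n. X (n + m) \<omega>) \<in> B)"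
proof -
  have "(\<lambda>\<omega> n. X (n + m) \<omega>) \<in> measurable M (\<Pi>\<^sub>M i\<in>UNIV. count_space UNIV)"
    by (rule measurable_PiM_single') auto
  from measure_distr[OF this assms] show ?thesis
    by (auto simp: path_law_def vimage_def Int_def conj_commute)
qed

lemma prob_shift:
  assumes "B \<in> sets (\<Pi>\<^sub>M i\<in>UNIV. count_space UNIV)"
  shows "\<P>(\<omega> in M. (\<lambda>n. X (n + m) \<omega>) \<in> B) = \<P>(\<omega> in M. path \<omega> \<in> B)"
proof -
  have "path_law M (\<lambda>n. X (n + m)) = path_law M (\<lambda>n. X (n + 0))"
    using stationary by (simp add: stationary_def)
  then show ?thesis
    using measure_path_law[OF assms, of m] measure_path_law[OF assms, of 0] by simp
qed

lemma prob_block: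
  "\<P>(\<omega> in M. block (path \<omega>) (i + 1) (i + int (length w)) = w) = word_prob w"
proof -
  let ?B = "{y. block y (- int (length w)) (-1) = w} :: (int \<Rightarrow> 'a) set"
  have "?B = (\<lambda>y. block y (- int (length w)) (-1)) -` {w} \<inter> space (\<Pi>\<^sub>M i\<in>UNIV. count_space UNIV)"
    by (auto simp: space_PiM)
  also have "\<dots> \<in> sets (\<Pi>\<^sub>M i\<in>UNIV. count_space (UNIV :: 'a set))"
    by (intro measurable_sets[OF measurable_block_component]) auto
  finally have B: "?B \<in> sets (\<Pi>\<^sub>M i\<in>UNIV. count_space (UNIV :: 'a set))" .
  show ?thesis
    using prob_shift[OF B, of "i + 1 + int (length w)"]
    by (simp add: word_prob_def suffix_of_past_def block_shift block_shift[of "path _"] algebra_simps)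
qed

lemma word_prob_nonneg: "0 \<le> word_prob w"
  by (simp add: word_prob_def)

lemma supp_star_iff: "w \<in> supp_star M X \<longleftrightarrow> 0 < word_prob w"
  by (simp add: supp_star_def word_prob_def)

lemma prob_suffix_and_next:
  "\<P>(\<omega> in M. X 0 \<omega> = a \<and> suffix_of_past (path \<omega>) (length u) = u) = word_prob (u @ [a])"
proof -
  have "block (path \<omega>) (- int (length u)) 0 = suffix_of_past (path \<omega>) (length u) @ [X 0 \<omega>]" for \<omega>
    using block_snoc[of "- int (length u)" "-1" "path \<omega>"] by (simp add: suffix_of_past_def)
  then show ?thesis
    using prob_block[of "- int (length u) - 1" "u @ [a]"] by (simp add: conj_commute)
qed

lemma p_word_eq: "p_word M X a u = word_prob (u @ [a]) / word_prob u"
  unfolding p_word_def cond_prob_def prob_suffix_and_next by (simp add: word_prob_def)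

sublocale word_law word_prob
proof
  show "word_prob [] = 1"
    by (simp add: word_prob_def suffix_of_past_def block_def prob_space)
  show "(\<Sum>b\<in>UNIV. word_prob (u @ [b])) = word_prob u" for u
  proof -
    have "(\<Sum>b\<in>UNIV. word_prob (u @ [b]))
        = (\<Sum>b\<in>UNIV. prob {\<omega> \<in> space M. X 0 \<omega> = b \<and> suffix_of_past (path \<omega>) (length u) = u})"
      by (simp add: prob_suffix_and_next)
    also have "\<dots> = prob (\<Union>b\<in>UNIV. {\<omega> \<in> space M. X 0 \<omega> = b \<and> suffix_of_past (path \<omega>) (length u) = u})"
      by (intro finite_measure_finite_Union[symmetric]) (auto simp: disjoint_family_on_def)
    also have "(\<Union>b\<in>UNIV. {\<omega> \<in> space M. X 0 \<omega> = b \<and> suffix_of_past (path \<omega>) (length u) = u})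
        = {\<omega> \<in> space M. suffix_of_past (path \<omega>) (length u) = u}"
      by auto
    finally show ?thesis by (simp add: word_prob_def)
  qed
qed (rule word_prob_nonneg)

lemma word_prob_suffix_mono:
  assumes "suffix w u"
  shows "word_prob u \<le> word_prob w"
proof -
  obtain v where u: "u = v @ w" using assms by (auto simp: suffix_def)
  have "suffix_of_past y (length w) = w" if "suffix_of_past y (length u) = u" for y
  proof -
    have "drop (length v) (suffix_of_past y (length u)) = suffix_of_past y (length w)"
      by (simp add: suffix_of_past_def drop_block u)
    then show ?thesis using that u by simp
  qed
  then show ?thesis
    unfolding word_prob_def by (intro finite_measure_mono) auto
qed

text \<open>The bridge from the finite sums of \<open>word_law\<close> to events of the
  sample.\<close>

lemma prob_sample:
  "\<P>(\<omega> in M. Q (block (path \<omega>) 1 (int n))) = (\<Sum>u\<in>words n. of_bool (Q u) * word_prob u)"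
proof -
  have "{\<omega> \<in> space M. Q (block (path \<omega>) 1 (int n))}
      = (\<Union>u\<in>words n \<inter> Collect Q. {\<omega> \<in> space M. block (path \<omega>) 1 (int n) = u})"
    by (auto simp: words_def)
  then have "\<P>(\<omega> in M. Q (block (path \<omega>) 1 (int n)))
      = (\<Sum>u\<in>words n \<inter> Collect Q. \<P>(\<omega> in M. block (path \<omega>) 1 (int n) = u))"
    by (simp add: finite_measure_finite_Union disjoint_family_on_def image_subset_iff)
       (intro finite_measure_finite_Union, auto simp: disjoint_family_on_def)
  also have "\<dots> = (\<Sum>u\<in>words n \<inter> Collect Q. word_prob u)"
  proof (intro sum.cong refl)
    fix u :: "'a list" assume "u \<in> words n \<inter> Collect Q"
    then show "\<P>(\<omega> in M. block (path \<omega>) 1 (int n) = u) = word_prob u"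
      using prob_block[of 0 u] by (simp add: words_def)
  qed
  also have "\<dots> = (\<Sum>u\<in>words n. of_bool (Q u) * word_prob u)"
    by (rule sum.mono_neutral_cong_left) auto
  finally show ?thesis .
qed

text \<open>The ergodic theorem is applied to the shift on path space and pulled back along
  \<open>path\<close>, since \<open>M\<close> itself carries no transformation.\<close>

lemma occ_frequency:
  assumes erg: "ergodic M X"
  shows "AE \<omega> in M. (\<lambda>n. real (occ (path \<omega>) n w) / real n) \<longlonglongrightarrow> word_prob w"
proof -
  let ?T = "\<lambda>y n. y (n + 1 :: int) :: 'a"
  let ?\<Pi> = "\<Pi>\<^sub>M i\<in>(UNIV::int set). count_space (UNIV :: 'a set)"
  let ?P = "path_law M X"
  let ?L = "length w"
  let ?f = "indicator {y. block y 1 (int ?L) = w} :: (int \<Rightarrow> 'a) \<Rightarrow> real"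
  have sets_P [measurable_cong]: "sets ?P = sets ?\<Pi>" by (simp add: path_law_def)
  have T: "?T \<in> measurable ?\<Pi> ?\<Pi>"
    by (rule measurable_PiM_single') (auto intro!: measurable_component_singleton)
  have "distr ?P ?P ?T = ?P"
  proof -
    have "distr ?P ?P ?T = distr ?P ?\<Pi> ?T" by (rule distr_cong) (auto simp: sets_P)
    also have "\<dots> = path_law M (\<lambda>n. X (n + 1))"
      unfolding path_law_def by (subst distr_distr[OF T path_measurable]) (simp add: comp_def)
    also have "\<dots> = ?P" using stationary by (simp add: stationary_def)
    finally show ?thesis .
  qed
  note T_invariant = this
  interpret P: prob_space ?P
    unfolding path_law_def by (intro prob_space_distr path_measurable)
  interpret P: ergodic_shift ?P ?T
  proof unfold_locales
    show "measure ?P B = 0 \<or> measure ?P B = 1" if "B \<in> sets ?P" "?T -` B \<inter> space ?P = B" for B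
      using erg that by (simp add: ergodic_def path_law_def space_PiM)
  qed (use T T_invariant sets_P in simp_all)
  have A: "{y. block y 1 (int ?L) = w} \<in> sets ?P"
  proof -
    have "{y. block y 1 (int ?L) = w} = (\<lambda>y. block y 1 (int ?L)) -` {w} \<inter> space ?\<Pi>"
      by (auto simp: space_PiM)
    also have "\<dots> \<in> sets ?\<Pi>"
      by (intro measurable_sets[OF measurable_block_component]) auto
    finally show ?thesis by (simp add: sets_P)
  qed
  have "measure ?P {y. block y 1 (int ?L) = w} = word_prob w"
    using measure_path_law[of "{y. block y 1 (int ?L) = w}" 0] A prob_block[of 0 w] by (simp add: sets_P)
  then have expectation_f: "(\<integral>y. ?f y \<partial>?P) = word_prob w" using A by simp
  have "integrable ?P ?f" using A by (simp add: P.emeasure_finite less_top[symmetric])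
  from P.birkhoff[OF this]
  have "AE y in ?P. (\<lambda>n. (\<Sum>i<n. ?f ((?T ^^ i) y)) / real n) \<longlonglongrightarrow> word_prob w"
    unfolding expectation_f .
  then have "AE \<omega> in M. (\<lambda>n. (\<Sum>i<n. ?f ((?T ^^ i) (path \<omega>))) / real n) \<longlonglongrightarrow> word_prob w"
    unfolding path_law_def by (rule AE_distrD[OF path_measurable])
  then show ?thesis
  proof (rule AE_mp, intro AE_I2 impI)
    fix \<omega>
    assume lim: "(\<lambda>n. (\<Sum>i<n. ?f ((?T ^^ i) (path \<omega>))) / real n) \<longlonglongrightarrow> word_prob w"
    have Ti: "(?T ^^ i) y = (\<lambda>n. y (n + int i))" for i y
      by (induction i) (auto simp: algebra_simps)
    \<comment> \<open>The Birkhoff sum has \<open>n + 1 - ?L\<close> terms instead of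
      \<open>n\<close>; this length tends to infinity, and its ratio to \<open>n\<close> tends to
      1.\<close>
    have m: "filterlim (\<lambda>n. n + 1 - ?L) sequentially sequentially"
      by (rule filterlim_at_top_mono[OF filterlim_minus_const_nat_at_top[of ?L]]) (simp add: always_eventually diff_le_mono)
    have "(\<lambda>n. real (n + 1 - ?L) / real n) \<longlonglongrightarrow> 1"
    proof (rule Lim_transform_eventually)
      show "(\<lambda>n. 1 + (1 - real ?L) / real n) \<longlonglongrightarrow> 1"
        using tendsto_add[OF tendsto_const[of 1] lim_const_over_n[of "1 - real ?L"]] by simp
      show "eventually (\<lambda>n. 1 + (1 - real ?L) / real n = real (n + 1 - ?L) / real n) sequentially"
        using eventually_ge_at_top[of "?L + 1"] by eventually_elim (auto simp: field_simps of_nat_diff)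
    qed
    from tendsto_mult[OF filterlim_compose[OF lim m] this]
    have "(\<lambda>n. real (occ (path \<omega>) n w) / real (n + 1 - ?L) * (real (n + 1 - ?L) / real n)) \<longlonglongrightarrow> word_prob w"
      by (simp add: occ_conv_sum Ti)
    then show "(\<lambda>n. real (occ (path \<omega>) n w) / real n) \<longlonglongrightarrow> word_prob w"
      by (rule Lim_transform_eventually)
         (rule eventually_mono[OF eventually_ge_at_top[of "?L + 1"]], simp)
  qed
qed

end

section \<open>The estimators\<close>

lemma suffix_suffix_of_past: "j \<le> k \<Longrightarrow> suffix (suffix_of_past x j) (suffix_of_past x k)"
proof -
  assume "j \<le> k"
  then have "drop (k - j) (suffix_of_past x k) = suffix_of_past x j"
    unfolding suffix_of_past_def block_def
    by (intro nth_equalityI) (auto simp: nth_upto of_nat_diff)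
  then show ?thesis by (metis suffix_drop)
qed

lemma length_suffix_of_past [simp]: "length (suffix_of_past x k) = k"
  by (simp add: suffix_of_past_def block_def)

lemma occ_eq_0: "j < length w \<Longrightarrow> occ s j w = 0"
  by (auto simp: occ_def)

lemma p_hat_minus_le: "suffix w w' \<Longrightarrow> p_hat_minus s n d a w \<le> p_hat s n a w' + cf_hat s n d w' a"
  unfolding p_hat_minus_def by (rule Min_le) (auto intro: finite_p_hat_minus_values)

lemma p_hat_minus_ge:
  assumes "\<And>w'. suffix w w' \<Longrightarrow> c \<le> p_hat s n a w' + cf_hat s n d w' a"
  shows "c \<le> p_hat_minus s n d a w"
  unfolding p_hat_minus_def
  by (rule Min.boundedI) (use assms in \<open>auto intro: finite_p_hat_minus_values\<close>)

lemma p_hat_minus_mono: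
  assumes "suffix w w'"
  shows "p_hat_minus s n d a w \<le> p_hat_minus s n d a w'"
  by (rule p_hat_minus_ge) (meson assms p_hat_minus_le suffix_order.trans)

text \<open>Extensions this long do not occur up to time \<open>n - 1\<close>, and unseen words have
  width 1. Hence the sums in \<open>h_hat\<close> reach 1 at a finite level and its
  \<open>LEAST\<close> is attained.\<close>

lemma p_hat_minus_unseen:
  fixes s :: "int \<Rightarrow> 'a::finite"
  assumes "n - 1 < length w"
  shows "1 \<le> p_hat_minus s n d a w"
proof (rule p_hat_minus_ge)
  fix w' assume "suffix w w'"
  then have "n - 1 < length w'" using assms suffix_length_le[of w w'] by linarith
  then show "1 \<le> p_hat s n a w' + cf_hat s n d w' a"
    by (simp add: p_hat_def cf_hat_def occ_eq_0)
qed

section \<open>The interpolated predictor for a fixed sample and past\<close>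

locale estimation =
  fixes s :: "int \<Rightarrow> 'a::finite" and n :: nat and d :: real and x :: "int \<Rightarrow> 'a"
begin

abbreviation q :: "'a \<Rightarrow> nat \<Rightarrow> real" where
  "q a k \<equiv> p_hat_minus s n d a (suffix_of_past x k)"

abbreviation Q :: "nat \<Rightarrow> real" where
  "Q k \<equiv> (\<Sum>a\<in>UNIV. q a k)"

abbreviation h :: nat where "h \<equiv> h_hat s n d x"

lemma q_mono: "j \<le> k \<Longrightarrow> q a j \<le> q a k"
  by (intro p_hat_minus_mono suffix_suffix_of_past)

lemma Q_h: "1 \<le> Q h"
proof -
  have "real CARD('a) * 1 \<le> Q (Suc n)"
    by (rule sum_bounded_below) (simp add: p_hat_minus_unseen)
  moreover have "1 \<le> real CARD('a)" by (simp add: Suc_le_eq)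
  ultimately have "1 \<le> Q (Suc n)" by linarith
  then show ?thesis unfolding h_hat_def by (rule LeastI)
qed

lemma Q_less_1: "k < h \<Longrightarrow> Q k < 1"
  unfolding h_hat_def by (drule not_less_Least) simp

lemma sum_p_hat_at: "(\<Sum>a\<in>UNIV. p_hat_at s n d a x) = Q h"
  by (simp add: p_hat_at_def)

lemma sum_p_hat_before_less_1: "(\<Sum>a\<in>UNIV. p_hat_before s n d a x) < 1"
  using Q_less_1[of "h - 1"] by (cases "h = 0") (simp_all add: p_hat_before_def)

text \<open>The mass is below 1 just before level \<open>h\<close> and at least 1 at it, so some
  mixture of the two levels has mass exactly 1; \<open>c\<close> is its weight.\<close>

lemma interpolation_weight:
  obtains c where "0 \<le> c" "c \<le> 1"
    "\<And>a. P_hat s n d a x = (1 - c) * p_hat_before s n d a x + c * q a h"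
    "c * (Q h - (\<Sum>a\<in>UNIV. p_hat_before s n d a x)) = 1 - (\<Sum>a\<in>UNIV. p_hat_before s n d a x)"
proof
  have Z: "Z_hat s n d x = Q h - (\<Sum>a\<in>UNIV. p_hat_before s n d a x)"
    by (simp add: Z_hat_def sum_subtractf sum_p_hat_at)
  then have Z0: "0 < Z_hat s n d x" using Q_h sum_p_hat_before_less_1 by linarith
  let ?c = "z_hat s n d x / Z_hat s n d x"
  show "0 \<le> ?c" using Z0 sum_p_hat_before_less_1 by (simp add: z_hat_def)
  show "?c \<le> 1" using Z0 Q_h Z by (simp add: z_hat_def)
  show "?c * (Q h - (\<Sum>a\<in>UNIV. p_hat_before s n d a x)) = 1 - (\<Sum>a\<in>UNIV. p_hat_before s n d a x)"
    using Z0 by (simp add: z_hat_def flip: Z)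
  show "P_hat s n d a x = (1 - ?c) * p_hat_before s n d a x + ?c * q a h" for a
    by (simp add: P_hat_def p_hat_at_def)
qed

lemma sum_P_hat: "(\<Sum>a\<in>UNIV. P_hat s n d a x) = 1"
proof -
  obtain c where c: "\<And>a. P_hat s n d a x = (1 - c) * p_hat_before s n d a x + c * q a h"
    "c * (Q h - (\<Sum>a\<in>UNIV. p_hat_before s n d a x)) = 1 - (\<Sum>a\<in>UNIV. p_hat_before s n d a x)"
    using interpolation_weight by blast
  have "(\<Sum>a\<in>UNIV. P_hat s n d a x) = (1 - c) * (\<Sum>a\<in>UNIV. p_hat_before s n d a x) + c * Q h"
    by (simp add: c(1) sum.distrib sum_distrib_left)
  then show ?thesis using c(2) by (simp add: algebra_simps)
qed

text \<open>Below \<open>h\<close> the mass is less than 1 and kept as it is; from \<open>h\<close>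
  on, \<open>P_hat\<close> has mass 1 while \<open>Q\<close> is at least 1.\<close>

lemma F_hat_eq: "F_hat s n d x k = min 1 (Q k)"
proof (cases "k < h")
  case True
  then show ?thesis using Q_less_1[OF True] by (simp add: F_hat_def P_hat_minus_def)
next
  case False
  then have "Q h \<le> Q k" by (intro sum_mono q_mono) simp
  then show ?thesis using False Q_h sum_P_hat by (simp add: F_hat_def P_hat_minus_def)
qed

lemma P_hat_ge_before:
  assumes "k < h"
  shows "q a k \<le> P_hat s n d a x"
proof -
  obtain c where c: "0 \<le> c" "P_hat s n d a x = (1 - c) * p_hat_before s n d a x + c * q a h"
    using interpolation_weight by blast
  have b: "p_hat_before s n d a x = q a (h - 1)" using assms by (simp add: p_hat_before_def)
  have "q a k \<le> q a (h - 1)" using assms by (intro q_mono) simp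
  moreover have "c * q a (h - 1) \<le> c * q a h" using c q_mono[of "h - 1" h a] by (intro mult_left_mono) auto
  ultimately show ?thesis using c(2) b by (simp add: algebra_simps)
qed

text \<open>Each letter has a nonnegative excess \<open>q b k - P_hat s n d b x\<close>, and the
  excesses add up to \<open>Q k - 1\<close>; the one at \<open>a\<close> is at most this
  total.\<close>

lemma P_hat_ge_after:
  assumes before: "\<And>b. p_hat_before s n d b x \<le> q b h" and "h \<le> k"
  shows "q a k - (Q k - 1) \<le> P_hat s n d a x"
proof -
  obtain c where c: "c \<le> 1" "\<And>a. P_hat s n d a x = (1 - c) * p_hat_before s n d a x + c * q a h"
    using interpolation_weight by blast
  have "P_hat s n d b x \<le> q b k" for b
  proof -
    have "(1 - c) * p_hat_before s n d b x \<le> (1 - c) * q b h"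
      using c(1) before by (intro mult_left_mono) auto
    then have "P_hat s n d b x \<le> q b h" by (simp add: c(2) algebra_simps)
    with q_mono[OF \<open>h \<le> k\<close>, of b] show ?thesis by linarith
  qed
  then have "q a k - P_hat s n d a x \<le> (\<Sum>b\<in>UNIV. q b k - P_hat s n d b x)"
    by (intro member_le_sum) auto
  then show ?thesis by (simp add: sum_subtractf sum_P_hat)
qed

end

lemma p_hat_minus_nonneg:
  fixes s :: "int \<Rightarrow> 'a::finite"
  assumes "0 \<le> t_star TYPE('a) n d"
  shows "0 \<le> p_hat_minus s n d a w"
  by (rule p_hat_minus_ge) (use assms in \<open>auto simp: p_hat_def cf_hat_def\<close>)

lemma P_hat_ge:
  fixes s :: "int \<Rightarrow> 'a::finite"
  assumes "0 \<le> t_star TYPE('a) n d"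
  shows "p_hat_minus s n d a (suffix_of_past x k)
      - max 0 ((\<Sum>b\<in>UNIV. p_hat_minus s n d b (suffix_of_past x k)) - 1) \<le> P_hat s n d a x"
proof -
  interpret estimation s n d x .
  \<comment> \<open>For \<open>h = 0\<close> the left side is 0 by convention, which is where
    nonnegativity enters.\<close>
  have "p_hat_before s n d b x \<le> q b h" for b
    using q_mono[of "h - 1" h b] p_hat_minus_nonneg[OF assms] by (simp add: p_hat_before_def)
  then show ?thesis
    using P_hat_ge_before[of k a] P_hat_ge_after[of k a] by (cases "k < h") (auto simp: max_def not_less)
qed

text \<open>Both masses are 1, so surplus and deficit balance and the distance is the deficit alone.
  This is how one-sided bounds on the predictor become convergence in total variation.\<close>

lemma dTV_eq_sum_pos_part:
  assumes "(\<Sum>a\<in>UNIV. p a) = 1" "(\<Sum>a\<in>UNIV. p' a) = 1"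
  shows "dTV p p' = (\<Sum>a\<in>UNIV. max 0 (p a - p' a))"
proof -
  have "(\<Sum>a\<in>UNIV. \<bar>p a - p' a\<bar>) = (\<Sum>a\<in>UNIV. 2 * max 0 (p a - p' a) - (p a - p' a))"
    by (intro sum.cong) (auto simp: max_def)
  also have "\<dots> = 2 * (\<Sum>a\<in>UNIV. max 0 (p a - p' a))"
    by (simp add: sum_subtractf assms flip: sum_distrib_left)
  finally show ?thesis by (simp add: dTV_def)
qed

lemma estimators_consistent:
  fixes s :: "int \<Rightarrow> 'a::finite" and p :: "'a \<Rightarrow> real"
  assumes t: "eventually (\<lambda>n. 0 \<le> t_star TYPE('a) n (\<delta> n)) sequentially"
    and q: "\<And>a k. (\<lambda>n. p_hat_minus s n (\<delta> n) a (suffix_of_past x k)) \<longlonglongrightarrow> q a k"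
    and q_le: "\<And>k. (\<Sum>a\<in>UNIV. q a k) \<le> 1"
    and p: "\<And>a. (\<lambda>k. q a k) \<longlonglongrightarrow> p a" and p_sum: "(\<Sum>a\<in>UNIV. p a) = 1"
  shows "(\<lambda>n. F_hat s n (\<delta> n) x k) \<longlonglongrightarrow> (\<Sum>a\<in>UNIV. q a k)"
    and "(\<lambda>n. dTV p (\<lambda>a. P_hat s n (\<delta> n) a x)) \<longlonglongrightarrow> 0"
proof -
  let ?q = "\<lambda>n a k. p_hat_minus s n (\<delta> n) a (suffix_of_past x k)"
  have "(\<lambda>n. min 1 (\<Sum>a\<in>UNIV. ?q n a k)) \<longlonglongrightarrow> min 1 (\<Sum>a\<in>UNIV. q a k)"
    by (intro tendsto_min tendsto_const tendsto_sum q)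
  then show "(\<lambda>n. F_hat s n (\<delta> n) x k) \<longlonglongrightarrow> (\<Sum>a\<in>UNIV. q a k)"
    using q_le[of k] by (simp add: estimation.F_hat_eq min_def split: if_splits)
  have "(\<lambda>n. max 0 (p a - P_hat s n (\<delta> n) a x)) \<longlonglongrightarrow> 0" for a
  proof (rule order_tendstoI)
    fix e :: real assume e: "0 < e"
    have "eventually (\<lambda>k. p a - e < q a k) sequentially"
      using e by (intro order_tendstoD(1)[OF p]) simp
    \<comment> \<open>The level is fixed by \<open>e\<close> before \<open>n\<close> grows, so the
      movement of \<open>h_hat\<close> with \<open>n\<close> is harmless.\<close>
    then obtain k where k: "p a - e < q a k" by (auto simp: eventually_sequentially)
    have "(\<lambda>n. ?q n a k - max 0 ((\<Sum>b\<in>UNIV. ?q n b k) - 1)) \<longlonglongrightarrow> q a k - max 0 ((\<Sum>b\<in>UNIV. q b k) - 1)"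
      by (intro tendsto_diff tendsto_max tendsto_sum tendsto_const q)
    \<comment> \<open>The correction vanishes in the limit because the limiting mass is at most
      1.\<close>
    then have "(\<lambda>n. ?q n a k - max 0 ((\<Sum>b\<in>UNIV. ?q n b k) - 1)) \<longlonglongrightarrow> q a k"
      using q_le[of k] by (simp add: max.absorb1)
    from order_tendstoD(1)[OF this k] t
    show "eventually (\<lambda>n. max 0 (p a - P_hat s n (\<delta> n) a x) < e) sequentially"
    proof eventually_elim
      case (elim n)
      then show ?case using P_hat_ge[of n "\<delta> n" s a x k] e by linarith
    qed
  qed (auto intro: always_eventually less_le_trans)
  then have "(\<lambda>n. \<Sum>a\<in>UNIV. max 0 (p a - P_hat s n (\<delta> n) a x)) \<longlonglongrightarrow> 0"
    by (intro tendsto_null_sum) simp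
  then show "(\<lambda>n. dTV p (\<lambda>a. P_hat s n (\<delta> n) a x)) \<longlonglongrightarrow> 0"
    by (simp add: dTV_eq_sum_pos_part p_sum estimation.sum_P_hat)
qed

text \<open>The form in which \<open>t_star\<close> enters the union bound. The factor 14 more than
  makes up for the half in \<open>(real n)\<^sup>2 / 2\<close>.\<close>

lemma t_star_pos:
  assumes "1 \<le> n" "0 < d" "d < 1"
  shows "real CARD('a::finite) * (real n)\<^sup>2 / d \<le> exp (t_star TYPE('a) n d)" "0 < t_star TYPE('a) n d"
proof -
  let ?Q = "real CARD('a) * (14 + 2 * log 2 (real n)) * (1 + (real n)\<^sup>2 / 2) / d"
  have A: "1 \<le> real CARD('a)" by (simp add: Suc_le_eq)
  have "0 \<le> log 2 (real n)" using assms by simp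
  then have "14 * (1 + (real n)\<^sup>2 / 2) \<le> (14 + 2 * log 2 (real n)) * (1 + (real n)\<^sup>2 / 2)"
    by (intro mult_right_mono) auto
  then have L: "14 + (real n)\<^sup>2 \<le> (14 + 2 * log 2 (real n)) * (1 + (real n)\<^sup>2 / 2)"
    by (rule order_trans[rotated]) (simp add: algebra_simps)
  then have L1: "1 < (14 + 2 * log 2 (real n)) * (1 + (real n)\<^sup>2 / 2)"
    using zero_le_power2[of "real n"] by linarith
  have "1 * 1 < real CARD('a) * ((14 + 2 * log 2 (real n)) * (1 + (real n)\<^sup>2 / 2))"
    by (rule mult_le_less_imp_less) (use A L1 in auto)
  then have Q: "1 < ?Q" using assms by (simp add: mult.assoc)
  then show "0 < t_star TYPE('a) n d" by (simp add: t_star_def)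
  have "real CARD('a) * (real n)\<^sup>2 \<le> real CARD('a) * ((14 + 2 * log 2 (real n)) * (1 + (real n)\<^sup>2 / 2))"
    using L by (intro mult_left_mono) auto
  then have "real CARD('a) * (real n)\<^sup>2 / d \<le> ?Q"
    using assms by (simp add: divide_right_mono mult.assoc)
  also have "?Q = exp (t_star TYPE('a) n d)" using Q by (simp add: t_star_def)
  finally show "real CARD('a::finite) * (real n)\<^sup>2 / d \<le> exp (t_star TYPE('a) n d)" .
qed

text \<open>As \<open>d < 1\<close> and \<open>1 \<le> A\<close>, the last hypothesis gives
  \<open>real n \<le> exp (t / 2)\<close>: the part of the exponent beyond \<open>t\<close> absorbs
  the third factor \<open>n\<close>.\<close>

lemma union_bound_le:
  fixes A::real
  assumes "1 \<le> n" "0 < d" "d < 1" "1 \<le> A" "A * (real n)\<^sup>2 / d \<le> exp t"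
  shows "A * real n ^ 3 * exp (- (3 * t / 2)) \<le> d"
proof -
  have "sqrt (A * (real n)\<^sup>2 / d) \<le> sqrt (exp t)" using assms(5) by simp
  moreover have "real n \<le> sqrt (A * (real n)\<^sup>2 / d)"
  proof (rule real_le_rsqrt)
    have "d * (real n)\<^sup>2 \<le> A * (real n)\<^sup>2" using assms by (intro mult_right_mono) auto
    then show "(real n)\<^sup>2 \<le> A * (real n)\<^sup>2 / d" using assms by (simp add: field_simps)
  qed
  moreover have "sqrt (exp t) = exp (t / 2)"
    by (rule real_sqrt_unique) (simp_all flip: exp_of_nat_mult)
  ultimately have "real n \<le> exp (t / 2)" by simp
  then have "A * (real n)\<^sup>2 / d * real n \<le> exp t * exp (t / 2)"
    using assms by (intro mult_mono) auto
  also have "\<dots> = exp (3 * t / 2)" by (simp flip: exp_add)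
  finally show ?thesis
    using assms by (simp add: exp_minus field_simps power3_eq_cube power2_eq_square)
qed

lemma t_star_sublinear:
  assumes d: "\<And>n. n \<ge> 1 \<Longrightarrow> 0 < \<delta> n \<and> \<delta> n < 1"
    and lim: "(\<lambda>n. ln (1 / \<delta> n) / real n) \<longlonglongrightarrow> 0"
  shows "(\<lambda>n. t_star TYPE('a::finite) n (\<delta> n) / real n) \<longlonglongrightarrow> 0"
proof -
  have pos: "0 < real CARD('a)" by simp
  have "(\<lambda>n. ln (real CARD('a) * (14 + 2 * log 2 (real n)) * (1 + (real n)\<^sup>2 / 2)) / real n) \<longlonglongrightarrow> 0"
    using pos by real_asymp
  from tendsto_add[OF this lim]
  have "(\<lambda>n. ln (real CARD('a) * (14 + 2 * log 2 (real n)) * (1 + (real n)\<^sup>2 / 2)) / real n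
      + ln (1 / \<delta> n) / real n) \<longlonglongrightarrow> 0" by simp
  then show ?thesis
  proof (rule Lim_transform_eventually)
    show "eventually (\<lambda>n. ln (real CARD('a) * (14 + 2 * log 2 (real n)) * (1 + (real n)\<^sup>2 / 2)) / real n
      + ln (1 / \<delta> n) / real n = t_star TYPE('a) n (\<delta> n) / real n) sequentially"
      using eventually_ge_at_top[of 1]
    proof eventually_elim
      case (elim n)
      have "0 \<le> log 2 (real n)" using elim by simp
      moreover have "0 < 1 + (real n)\<^sup>2 / 2" using zero_le_power2[of "real n"] by linarith
      ultimately have R: "0 < real CARD('a) * (14 + 2 * log 2 (real n)) * (1 + (real n)\<^sup>2 / 2)"
        by simp
      have "ln (r / \<delta> n) = ln r + ln (1 / \<delta> n)" if "0 < r" for r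
        using that d[OF elim] by (simp add: ln_div)
      from this[OF R] show ?case by (simp add: t_star_def add_divide_distrib)
    qed
  qed
qed

section \<open>Consistency\<close>

context stationary_process
begin

section \<open>Infima of one-step probabilities over the extensions of a word\<close>

lemma p_word_nonneg: "0 \<le> p_word M X a w"
  by (simp add: p_word_eq word_prob_nonneg)

lemma sum_p_word: "w \<in> supp_star M X \<Longrightarrow> (\<Sum>a\<in>UNIV. p_word M X a w) = 1"
  by (simp add: p_word_eq supp_star_iff snoc flip: sum_divide_distrib)

lemma p_word_le_1: "p_word M X a w \<le> 1"
proof -
  have "word_prob (w @ [a]) \<le> (\<Sum>b\<in>UNIV. word_prob (w @ [b]))"
    by (intro member_le_sum word_prob_nonneg) auto
  then show ?thesis
    using word_prob_nonneg[of w] by (cases "word_prob w = 0") (simp_all add: p_word_eq snoc)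
qed

lemma supp_star_suffix: "u \<in> supp_star M X \<Longrightarrow> suffix w u \<Longrightarrow> w \<in> supp_star M X"
  using word_prob_suffix_mono[of w u] by (simp add: supp_star_iff)

lemma p_word_bdd_below: "bdd_below ((\<lambda>w. p_word M X a w) ` W)"
  by (rule bdd_belowI2[where m = 0]) (rule p_word_nonneg)

lemma p_minus_supp_le:
  "u \<in> supp_star M X \<Longrightarrow> suffix w u \<Longrightarrow> p_minus_supp M X a w \<le> p_word M X a u"
  unfolding p_minus_supp_def by (intro cINF_lower p_word_bdd_below) auto

lemma p_minus_supp_ge:
  assumes "w \<in> supp_star M X" "\<And>u. u \<in> supp_star M X \<Longrightarrow> suffix w u \<Longrightarrow> c \<le> p_word M X a u"
  shows "c \<le> p_minus_supp M X a w"
  unfolding p_minus_supp_def by (rule cINF_greatest) (use assms in auto)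

lemma p_minus_supp_mono:
  "u \<in> supp_star M X \<Longrightarrow> suffix w u \<Longrightarrow> p_minus_supp M X a w \<le> p_minus_supp M X a u"
  by (rule p_minus_supp_ge) (auto intro: p_minus_supp_le dest: suffix_order.trans)

lemma p_minus_supp_le_1: "w \<in> supp_star M X \<Longrightarrow> p_minus_supp M X a w \<le> 1"
  using p_minus_supp_le[of w w a] p_word_le_1[of a w] by simp

lemma p_minus_on_supp: "w \<in> supp_star M X \<Longrightarrow> p_minus M X a w = p_minus_supp M X a w"
  by (simp add: p_minus_def)

lemma sum_p_minus_supp_le_1: "w \<in> supp_star M X \<Longrightarrow> (\<Sum>a\<in>UNIV. p_minus_supp M X a w) \<le> 1"
  using sum_mono[of UNIV "\<lambda>a. p_minus_supp M X a w" "\<lambda>a. p_word M X a w"] p_minus_supp_le[of w w]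
  by (simp add: sum_p_word)

text \<open>Turns continuity into mass: where \<open>ct\<close> is small, the infima add up to
  nearly 1. A coordinate moves by at most twice the total variation distance, hence by at most
  \<open>2 * ct M X w\<close>.\<close>

lemma sum_p_minus_supp_ge:
  assumes w: "w \<in> supp_star M X"
  shows "1 - 2 * real CARD('a) * ct M X w \<le> (\<Sum>a\<in>UNIV. p_minus_supp M X a w)"
proof -
  have "p_word M X a w - 2 * ct M X w \<le> p_minus_supp M X a w" for a
  proof (rule p_minus_supp_ge[OF w])
    fix u assume u: "u \<in> supp_star M X" "suffix w u"
    \<comment> \<open>The real supremum in \<open>ct\<close> dominates its members once the set is
      known to be bounded.\<close>
    have "dTV (\<lambda>a. p_word M X a u') (\<lambda>a. p_word M X a w) \<le> real CARD('a)" for u'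
    proof -
      have "(\<Sum>a\<in>UNIV. \<bar>p_word M X a u' - p_word M X a w\<bar>) \<le> (\<Sum>a\<in>(UNIV::'a set). 1)"
      proof (rule sum_mono)
        fix a
        show "\<bar>p_word M X a u' - p_word M X a w\<bar> \<le> 1"
          using p_word_nonneg[of a u'] p_word_nonneg[of a w] p_word_le_1[of a u'] p_word_le_1[of a w]
          by linarith
      qed
      then show ?thesis by (simp add: dTV_def)
    qed
    then have "dTV (\<lambda>a. p_word M X a u) (\<lambda>a. p_word M X a w) \<le> ct M X w"
      unfolding ct_def using u by (intro cSUP_upper bdd_aboveI2) auto
    moreover have "\<bar>p_word M X a u - p_word M X a w\<bar> \<le> (\<Sum>a\<in>UNIV. \<bar>p_word M X a u - p_word M X a w\<bar>)"
      by (rule member_le_sum) auto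
    ultimately show "p_word M X a w - 2 * ct M X w \<le> p_word M X a u"
      unfolding dTV_def by linarith
  qed
  then have "(\<Sum>a\<in>UNIV. p_word M X a w - 2 * ct M X w) \<le> (\<Sum>a\<in>UNIV. p_minus_supp M X a w)"
    by (intro sum_mono)
  then show ?thesis by (simp add: sum_subtractf sum_p_word[OF w] mult_ac)
qed

text \<open>The value off the support is irrelevant for the concentration bound, as such words almost
  surely do not occur; with 1 they need no special treatment there.\<close>

definition lower :: "'a \<Rightarrow> 'a list \<Rightarrow> real" where
  "lower a w = (if w \<in> supp_star M X then p_minus_supp M X a w else 1)"

text \<open>The product form extends the bound to null words \<open>u\<close>, where
  \<open>p_word\<close> is 0 while \<open>lower\<close> may be 1.\<close>

lemma lower_le: "suffix w u \<Longrightarrow> lower a w * word_prob u \<le> word_prob (u @ [a])"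
proof (cases "u \<in> supp_star M X")
  case True
  moreover assume "suffix w u"
  ultimately have "lower a w \<le> p_word M X a u"
    using supp_star_suffix[of u w] p_minus_supp_le[of u w a] by (simp add: lower_def)
  then show ?thesis using True by (simp add: p_word_eq supp_star_iff field_simps)
next
  case False
  then have "word_prob u = 0" using word_prob_nonneg[of u] by (simp add: supp_star_iff)
  then show ?thesis using word_prob_nonneg by simp
qed

text \<open>The bad event at sample size \<open>n\<close> has probability at most
  \<open>\<delta> n\<close>, so Borel-Cantelli applies. The quantifiers over \<open>w\<close> and
  \<open>a\<close> stand inside \<open>eventually\<close>: the threshold is common to all
  words.\<close>

lemma eventually_confidence:
  assumes \<delta>: "\<And>n. n \<ge> 1 \<Longrightarrow> 0 < \<delta> n \<and> \<delta> n < 1" and summable: "summable \<delta>"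
  shows "AE \<omega> in M. eventually (\<lambda>n. \<forall>w a.
      lower a w \<le> p_hat (path \<omega>) n a w + cf_hat (path \<omega>) n (\<delta> n) w a
      \<or> occ (path \<omega>) (n - 1) w = 0) sequentially"
proof -
  let ?t = "\<lambda>n. t_star TYPE('a) n (\<delta> n)"
  define Q where "Q = (\<lambda>n u. \<exists>w a. 0 < visits w u \<and>
             real (hits w a u) + 2 * sqrt (real (hits w a u) * ?t n) + (2 + sqrt 2) * ?t n
               < lower a w * real (visits w u))"
  define B where "B = (\<lambda>n. {\<omega> \<in> space M. Q n (block (path \<omega>) 1 (int n))})"
  have B: "B n \<in> sets M" for n
    unfolding B_def by measurable
  have "prob (B n) \<le> \<delta> n" if n: "1 \<le> n" for n
  proof -
    note t = t_star_pos[where ?'a = 'a, OF n \<delta>[OF n, THEN conjunct1] \<delta>[OF n, THEN conjunct2]]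
    have "prob (B n) \<le> real CARD('a) * real n ^ 3 * exp (- (3 * ?t n / 2))"
      unfolding B_def prob_sample[of "Q n"] unfolding Q_def by (intro uniform_lower_tail t lower_le)
    also have "\<dots> \<le> \<delta> n"
      by (rule union_bound_le) (use n \<delta>[OF n] t in \<open>auto simp: Suc_le_eq\<close>)
    finally show ?thesis .
  qed
  then have "summable (\<lambda>n. prob (B n))"
    by (intro summable_comparison_test'[OF summable, of 1]) auto
  then have "AE \<omega> in M. eventually (\<lambda>n. \<omega> \<in> space M - B n) sequentially"
    by (intro borel_cantelli_AE1 B) (auto simp: emeasure_eq_measure)
  then show ?thesis
  proof (rule AE_mp, intro AE_I2 impI)
    fix \<omega> assume "\<omega> \<in> space M" "eventually (\<lambda>n. \<omega> \<in> space M - B n) sequentially"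
    from this(2) eventually_ge_at_top[of 1]
    show "eventually (\<lambda>n. \<forall>w a.
      lower a w \<le> p_hat (path \<omega>) n a w + cf_hat (path \<omega>) n (\<delta> n) w a
      \<or> occ (path \<omega>) (n - 1) w = 0) sequentially"
    proof eventually_elim
      case (elim n)
      show ?case
      proof (intro allI)
        fix w a
        define v where "v = real (occ (path \<omega>) (n - 1) w)"
        define k where "k = real (occ (path \<omega>) n (w @ [a]))"
        have "lower a w \<le> p_hat (path \<omega>) n a w + cf_hat (path \<omega>) n (\<delta> n) w a" if "0 < v"
        proof -
          have "\<not> Q n (block (path \<omega>) 1 (int n))" using elim \<open>\<omega> \<in> space M\<close> by (simp add: B_def)
          \<comment> \<open>Division by the number of visits turns the counts into
            \<open>p_hat\<close> and the two deviation terms into \<open>cf_hat\<close>.\<close>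
          then have "lower a w * v \<le> k + 2 * sqrt (k * ?t n) + (2 + sqrt 2) * ?t n"
            using that elim(2) unfolding Q_def v_def k_def
            by (auto simp: visits_block hits_block not_less dest!: spec[of _ w] spec[of _ a])
          then have "lower a w \<le> (k + 2 * sqrt (k * ?t n) + (2 + sqrt 2) * ?t n) / v"
            using that by (simp add: pos_le_divide_eq)
          also have "\<dots> = k / v + (2 * sqrt (k / v * (?t n / v)) + (2 + sqrt 2) * (?t n / v))"
            using that by (simp add: real_sqrt_divide add_divide_distrib power2_eq_square[symmetric])
          finally show ?thesis
            using that by (simp add: p_hat_def cf_hat_def flip: v_def k_def) (simp add: v_def)
        qed
        then show "lower a w \<le> p_hat (path \<omega>) n a w + cf_hat (path \<omega>) n (\<delta> n) w a
            \<or> occ (path \<omega>) (n - 1) w = 0"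
          unfolding v_def by auto
      qed
    qed
  qed
qed

end

text \<open>Visits to \<open>w\<close> grow linearly while \<open>t_star\<close> is sublinear, so
  the width vanishes; dividing everything by \<open>n\<close> makes this a limit of ratios.\<close>

lemma p_hat_cf_hat_tendsto:
  fixes s :: "int \<Rightarrow> 'a::finite"
  assumes freq: "\<And>w. (\<lambda>n. real (occ s n w) / real n) \<longlonglongrightarrow> \<mu> w" and w: "0 < \<mu> w"
    and t: "(\<lambda>n. t_star TYPE('a) n (\<delta> n) / real n) \<longlonglongrightarrow> 0"
  shows "(\<lambda>n. p_hat s n a w + cf_hat s n (\<delta> n) w a) \<longlonglongrightarrow> \<mu> (w @ [a]) / \<mu> w"
proof -
  let ?v = "\<lambda>n. real (occ s (n - 1) w)" and ?k = "\<lambda>n. real (occ s n (w @ [a]))"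
    and ?t = "\<lambda>n. t_star TYPE('a) n (\<delta> n)"
  have v: "(\<lambda>n. ?v n / real n) \<longlonglongrightarrow> \<mu> w"
  \<comment> \<open>The count stops at \<open>n - 1\<close> but is divided by \<open>n\<close>;
    reindexing removes the subtraction.\<close>
  proof (subst filterlim_sequentially_Suc[symmetric])
    have "(\<lambda>n. real (occ s n w) / real n * (real n / real (Suc n))) \<longlonglongrightarrow> \<mu> w"
      using tendsto_mult[OF freq[of w] LIMSEQ_n_over_Suc_n] unfolding mult_1_right .
    then show "(\<lambda>n. real (occ s (Suc n - 1) w) / real (Suc n)) \<longlonglongrightarrow> \<mu> w"
      by (rule Lim_transform_eventually) (rule eventually_mono[OF eventually_gt_at_top[of 0]], simp)
  qed
  have "(\<lambda>n. (?k n / real n) / (?v n / real n)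
      + (2 * sqrt ((?k n / real n) / (?v n / real n) * ((?t n / real n) / (?v n / real n)))
         + (2 + sqrt 2) * ((?t n / real n) / (?v n / real n))))
      \<longlonglongrightarrow> \<mu> (w @ [a]) / \<mu> w
        + (2 * sqrt (\<mu> (w @ [a]) / \<mu> w * (0 / \<mu> w)) + (2 + sqrt 2) * (0 / \<mu> w))"
    using w by (intro tendsto_intros freq t v) auto
  then have "(\<lambda>n. (?k n / real n) / (?v n / real n)
      + (2 * sqrt ((?k n / real n) / (?v n / real n) * ((?t n / real n) / (?v n / real n)))
         + (2 + sqrt 2) * ((?t n / real n) / (?v n / real n)))) \<longlonglongrightarrow> \<mu> (w @ [a]) / \<mu> w"
    by simp
  then show ?thesis
  proof (rule Lim_transform_eventually)
    show "eventually (\<lambda>n. (?k n / real n) / (?v n / real n)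
      + (2 * sqrt ((?k n / real n) / (?v n / real n) * ((?t n / real n) / (?v n / real n)))
         + (2 + sqrt 2) * ((?t n / real n) / (?v n / real n)))
      = p_hat s n a w + cf_hat s n (\<delta> n) w a) sequentially"
      using order_tendstoD(1)[OF v w] eventually_gt_at_top[of 0]
    proof eventually_elim
      case (elim n)
      then have "0 < occ s (n - 1) w" by (cases "occ s (n - 1) w = 0") auto
      then show ?case using elim(2) by (simp add: p_hat_def cf_hat_def)
    qed
  qed
qed

context stationary_process
begin

text \<open>From below, \<open>conf\<close> handles all seen extensions of \<open>w\<close> at once,
  and unseen ones have width 1. From above, a single extension with \<open>p_word\<close> close to
  the infimum is enough.\<close>

lemma p_hat_minus_tendsto:
  fixes s :: "int \<Rightarrow> 'a"
  assumes freq: "\<And>w. (\<lambda>n. real (occ s n w) / real n) \<longlonglongrightarrow> word_prob w"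
    and t: "(\<lambda>n. t_star TYPE('a) n (\<delta> n) / real n) \<longlonglongrightarrow> 0"
    and conf: "eventually (\<lambda>n. \<forall>w a. lower a w \<le> p_hat s n a w + cf_hat s n (\<delta> n) w a
      \<or> occ s (n - 1) w = 0) sequentially"
    and w: "w \<in> supp_star M X"
  shows "(\<lambda>n. p_hat_minus s n (\<delta> n) a w) \<longlonglongrightarrow> p_minus_supp M X a w"
proof (rule order_tendstoI)
  fix c assume c: "c < p_minus_supp M X a w"
  show "eventually (\<lambda>n. c < p_hat_minus s n (\<delta> n) a w) sequentially"
    using conf
  proof eventually_elim
    case (elim n)
    have "p_minus_supp M X a w \<le> p_hat_minus s n (\<delta> n) a w"
    proof (rule p_hat_minus_ge)
      fix w' assume w': "suffix w w'"
      \<comment> \<open>Extending within the support can only raise the infimum, and leaving the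
        support raises \<open>lower\<close> to 1.\<close>
      have le: "p_minus_supp M X a w \<le> lower a w'"
        using p_minus_supp_mono[OF _ w'] p_minus_supp_le_1[OF w] by (simp add: lower_def)
      show "p_minus_supp M X a w \<le> p_hat s n a w' + cf_hat s n (\<delta> n) w' a"
      proof (cases "occ s (n - 1) w' = 0")
        case True
        then show ?thesis using p_minus_supp_le_1[OF w, of a] by (simp add: p_hat_def cf_hat_def add_increasing)
      next
        case False
        then show ?thesis using elim le by (meson order_trans)
      qed
    qed
    then show ?case using c by linarith
  qed
next
  fix c assume "p_minus_supp M X a w < c"
  then obtain u where u: "u \<in> supp_star M X" "suffix w u" "p_word M X a u < c"
    unfolding p_minus_supp_def using w
    by (subst (asm) cINF_less_iff[OF _ p_word_bdd_below]) auto
  have "eventually (\<lambda>n. p_hat s n a u + cf_hat s n (\<delta> n) u a < c) sequentially"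
    using p_hat_cf_hat_tendsto[of s word_prob u \<delta> a, OF freq _ t] u
    by (intro order_tendstoD(2)) (auto simp: supp_star_iff p_word_eq)
  then show "eventually (\<lambda>n. p_hat_minus s n (\<delta> n) a w < c) sequentially"
    by eventually_elim (use p_hat_minus_le[OF u(2)] le_less_trans in blast)
qed

section \<open>Typical pasts\<close>

lemma AE_suffix_in_supp: "AE \<omega> in M. \<forall>k. suffix_of_past (path \<omega>) k \<in> supp_star M X"
proof -
  have "AE \<omega> in M. suffix_of_past (path \<omega>) (length w) = w \<longrightarrow> w \<in> supp_star M X" for w
  proof (cases "w \<in> supp_star M X")
    case False
    then have "word_prob w = 0" using word_prob_nonneg[of w] by (simp add: supp_star_iff)
    then have "prob {\<omega> \<in> space M. suffix_of_past (path \<omega>) (length w) = w} = 0"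
      by (simp add: word_prob_def)
    moreover have "{\<omega> \<in> space M. suffix_of_past (path \<omega>) (length w) = w} \<in> sets M" by measurable
    ultimately have "AE \<omega> in M. \<omega> \<notin> {\<omega> \<in> space M. suffix_of_past (path \<omega>) (length w) = w}"
      by (simp add: prob_eq_0)
    then show ?thesis using AE_space by eventually_elim simp
  qed simp
  then have "AE \<omega> in M. \<forall>w. suffix_of_past (path \<omega>) (length w) = w \<longrightarrow> w \<in> supp_star M X"
    by (simp add: AE_all_countable)
  then show ?thesis
    by (rule AE_mp) (auto intro!: AE_I2 dest: spec[of _ "suffix_of_past (path _) _"])
qed

text \<open>On these pasts the limits of \<open>p_minus\<close> already have mass 1, so the uniform
  correction in \<open>p_past\<close> vanishes. \<open>full\<close> has countable quantifiers only,
  which keeps the set of such pasts measurable; monotonicity in \<open>k\<close> recovers the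
  limit.\<close>

lemma p_past_limits:
  assumes supp: "\<And>k. suffix_of_past x k \<in> supp_star M X"
    and full: "\<And>m. \<exists>k. 1 - 1 / real (Suc m) < (\<Sum>a\<in>UNIV. p_minus M X a (suffix_of_past x k))"
  shows "(\<lambda>k. p_minus M X a (suffix_of_past x k)) \<longlonglongrightarrow> p_past M X a x"
    and "(\<Sum>a\<in>UNIV. p_past M X a x) = 1"
proof -
  let ?q = "\<lambda>a k. p_minus M X a (suffix_of_past x k)"
  have mono: "?q a j \<le> ?q a k" if "j \<le> k" for a j k
    using p_minus_supp_mono[OF supp suffix_suffix_of_past[OF that]] by (simp add: p_minus_on_supp supp)
  have "convergent (?q a)" for a
  proof (rule Bseq_mono_convergent)
    have "norm (?q a k) \<le> 1" for k
      using p_minus_supp_le_1[OF supp] p_minus_supp_ge[OF supp p_word_nonneg]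
      by (simp add: p_minus_on_supp supp abs_le_iff add_increasing)
    then show "Bseq (?q a)" by (rule BseqI')
  qed (use mono in auto)
  then have lim: "?q a \<longlonglongrightarrow> p_minus_lim M X a x" for a
    by (simp add: p_minus_lim_def convergent_LIMSEQ_iff)
  have S: "(\<lambda>k. \<Sum>a\<in>UNIV. ?q a k) \<longlonglongrightarrow> (\<Sum>a\<in>UNIV. p_minus_lim M X a x)"
    by (intro tendsto_sum lim)
  have "(\<Sum>a\<in>UNIV. p_minus_lim M X a x) \<le> 1"
    by (rule LIMSEQ_le_const2[OF S]) (auto simp: p_minus_on_supp supp sum_p_minus_supp_le_1)
  moreover have "1 - 1 / real (Suc m) \<le> (\<Sum>a\<in>UNIV. p_minus_lim M X a x)" for m
  proof -
    obtain k where k: "1 - 1 / real (Suc m) < (\<Sum>a\<in>UNIV. ?q a k)" using full by blast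
    have "(\<Sum>a\<in>UNIV. ?q a k) \<le> (\<Sum>a\<in>UNIV. p_minus_lim M X a x)"
      by (rule LIMSEQ_le_const[OF S]) (auto intro!: sum_mono mono)
    with k show ?thesis by linarith
  qed
  then have "1 - 0 \<le> (\<Sum>a\<in>UNIV. p_minus_lim M X a x)"
    by (intro LIMSEQ_le_const2[OF tendsto_diff[OF tendsto_const LIMSEQ_Suc[OF lim_1_over_n]]]) auto
  ultimately have sum1: "(\<Sum>a\<in>UNIV. p_minus_lim M X a x) = 1" by simp
  then show "(\<Sum>a\<in>UNIV. p_past M X a x) = 1" by (simp add: p_past_def)
  show "?q a \<longlonglongrightarrow> p_past M X a x" using lim[of a] sum1 by (simp add: p_past_def)
qed

lemma AE_sum_p_minus_near_1:
  assumes "almost_surely_continuous M X"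
  shows "AE \<omega> in M. \<forall>m. \<exists>k. 1 - 1 / real (Suc m) <
    (\<Sum>a\<in>UNIV. p_minus M X a (suffix_of_past (path \<omega>) k))"
  using assms[unfolded almost_surely_continuous_def] AE_suffix_in_supp
proof (rule AE_mp[OF _ AE_mp], intro AE_I2 impI allI)
  fix \<omega> and m :: nat
  assume supp: "\<forall>k. suffix_of_past (path \<omega>) k \<in> supp_star M X"
    and lim: "(\<lambda>k. ct M X (suffix_of_past (path \<omega>) k)) \<longlonglongrightarrow> 0"
  have A: "0 < real CARD('a)" by simp
  then have "0 < 1 / real (Suc m) / (2 * real CARD('a))" by simp
  from order_tendstoD(2)[OF lim this]
  obtain k where "ct M X (suffix_of_past (path \<omega>) k) < 1 / real (Suc m) / (2 * real CARD('a))"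
    by (auto simp: eventually_sequentially)
  moreover have "2 * r * c < e" if "c < e / (2 * r)" "0 < r" for r c e :: real
    using that by (simp add: field_simps)
  ultimately have "2 * real CARD('a) * ct M X (suffix_of_past (path \<omega>) k) < 1 / real (Suc m)"
    using A by blast
  then show "\<exists>k. 1 - 1 / real (Suc m) < (\<Sum>a\<in>UNIV. p_minus M X a (suffix_of_past (path \<omega>) k))"
    using sum_p_minus_supp_ge[OF supp[rule_format, of k]] supp
    by (intro exI[of _ k]) (simp add: p_minus_on_supp)
qed

end

section \<open>Transfer to the probability space of the representation\<close>

lemma process_measurable: "process M X \<Longrightarrow> X n \<in> measurable M (count_space UNIV)"
  by (simp add: process_def)

lemma path_measurable:
  "process M X \<Longrightarrow> (\<lambda>\<omega> n. X n \<omega>) \<in> measurable M (\<Pi>\<^sub>M i\<in>UNIV. count_space UNIV)"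
  by (rule measurable_PiM_single') (auto simp: process_def)

lemma past_measurable: "process M X \<Longrightarrow> past X \<in> measurable M past_space"
  unfolding past_def past_space_def
  by (rule measurable_restrict) (auto simp: process_def)

lemma past_law_eq_distr_path_law:
  fixes X :: "int \<Rightarrow> 'w \<Rightarrow> 's::countable"
  assumes "process M X"
  shows "past_law M X = distr (path_law M X) past_space (\<lambda>y. restrict y {..<0})"
proof -
  have R: "(\<lambda>y. restrict y {..<0}) \<in> measurable (\<Pi>\<^sub>M i\<in>UNIV. count_space (UNIV :: 's set)) past_space"
    unfolding past_space_def by (rule measurable_restrict_subset) simp
  show ?thesis
    unfolding path_law_def past_law_def
    by (subst distr_distr[OF R path_measurable[OF assms]]) (simp add: comp_def past_def[abs_def])
qed

lemma prob_path_cong: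
  fixes X :: "int \<Rightarrow> 'w \<Rightarrow> 's::countable" and Y :: "int \<Rightarrow> 'v \<Rightarrow> 's"
  assumes XY: "process M X" "process N Y" "path_law N Y = path_law M X"
    and B: "B \<in> sets (\<Pi>\<^sub>M i\<in>(UNIV::int set). count_space (UNIV :: 's set))"
  shows "\<P>(\<omega> in N. (\<lambda>n. Y n \<omega>) \<in> B) = \<P>(\<omega> in M. (\<lambda>n. X n \<omega>) \<in> B)"
  using measure_distr[OF path_measurable[OF XY(1)] B] measure_distr[OF path_measurable[OF XY(2)] B] XY(3)
  by (simp add: path_law_def vimage_def Int_def conj_commute)

lemma word_event_sets:
  "{y. suffix_of_past y k = w \<and> y 0 \<in> A} \<in> sets (\<Pi>\<^sub>M i\<in>(UNIV::int set). count_space (UNIV :: 's::countable set))"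
proof -
  let ?P = "\<Pi>\<^sub>M i\<in>(UNIV::int set). count_space (UNIV :: 's set)"
  have [measurable]: "(\<lambda>y. suffix_of_past y k) \<in> measurable ?P (count_space UNIV)"
    unfolding suffix_of_past_def by (rule measurable_block_component) simp
  have [measurable]: "(\<lambda>y. y 0) \<in> measurable ?P (count_space UNIV)"
    by (rule measurable_component_singleton) simp
  have "{y \<in> space ?P. suffix_of_past y k = w \<and> y 0 \<in> A} \<in> sets ?P" by measurable
  then show ?thesis by (simp add: space_PiM)
qed

text \<open>The representation lives on a space of its own; \<open>p_minus\<close> is the same there
  because it depends on the path law alone.\<close>

lemma p_minus_cong:
  fixes X :: "int \<Rightarrow> 'w \<Rightarrow> 'a::finite" and Y :: "int \<Rightarrow> 'v \<Rightarrow> 'a"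
  assumes XY: "process M X" "process N Y" "path_law N Y = path_law M X"
  shows "p_minus N Y = p_minus M X"
proof -
  have S: "\<P>(\<omega> in N. suffix_of_past (\<lambda>n. Y n \<omega>) (length w) = w)
      = \<P>(\<omega> in M. suffix_of_past (\<lambda>n. X n \<omega>) (length w) = w)" for w
    using prob_path_cong[OF XY word_event_sets[of "length w" w UNIV]] by simp
  have "p_word N Y a w = p_word M X a w" for a w
    using prob_path_cong[OF XY word_event_sets[of "length w" w "{a}"]] S[of w]
    by (simp add: p_word_def cond_prob_def conj_commute)
  moreover have "supp_star N Y = supp_star M X" by (simp add: supp_star_def S)
  ultimately show ?thesis
    by (intro ext) (simp add: p_minus_def p_minus_supp_def longest_supp_suffix_def)
qed

lemma suffix_of_past_past: "suffix_of_past (past X \<omega>) k = suffix_of_past (\<lambda>n. X n \<omega>) k"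
  unfolding suffix_of_past_def past_def by (rule block_cong) simp

lemma minimal_rcr_process:
  assumes "minimal_rcr N Y K"
  shows "process N Y" "process N K"
proof -
  have P: "prob_space N" and YK: "(\<lambda>\<omega>. (Y n \<omega>, K n \<omega>)) \<in> measurable N (count_space UNIV)" for n
    using assms by (auto simp: minimal_rcr_def stationary_def process_def)
  have "Y n \<in> measurable N (count_space UNIV)" "K n \<in> measurable N (count_space UNIV)" for n
    using measurable_compose[OF YK[of n], of fst "count_space UNIV"]
      measurable_compose[OF YK[of n], of snd "count_space UNIV"] by simp_all
  then show "process N Y" "process N K" using P by (auto simp: process_def)
qed

text \<open>Splitting the event by the value of \<open>Y 0\<close> gives one conditional probability
  per letter, and \<open>minimal_rcr\<close> identifies each of them with
  \<open>p_minus\<close>.\<close>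

lemma version_eq_sum_p_minus:
  assumes rep: "minimal_rcr N Y K" and ver: "version_given_past N Y (\<lambda>\<omega>. K 0 \<omega> \<le> enat k) g"
  shows "AE \<omega> in N. g (past Y \<omega>) = (\<Sum>a\<in>UNIV. p_minus N Y a (suffix_of_past (past Y \<omega>) k))"
proof -
  note proc = minimal_rcr_process[OF rep]
  interpret prob_space N using proc by (simp add: process_def)
  have [measurable]: "Y n \<in> measurable N (count_space UNIV)" "K n \<in> measurable N (count_space UNIV)" for n
    using proc by (auto intro: process_measurable)
  let ?F = "coord_algebra N Y {..<0}"
  have "(\<lambda>\<omega>. \<lambda>n\<in>{..<0}. Y n \<omega>) \<in> measurable N (\<Pi>\<^sub>M i\<in>{..<0}. count_space UNIV)"
    by (rule measurable_restrict) simp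
  then have "subalgebra N ?F"
    unfolding subalgebra_def coord_algebra_def by (simp add: sets_image_in_sets)
  then interpret F: finite_measure_subalgebra N ?F by unfold_locales
  let ?E = "\<lambda>a. {\<omega> \<in> space N. Y 0 \<omega> = a \<and> K 0 \<omega> \<le> enat k}"
  have E [measurable]: "?E a \<in> sets N" for a by measurable
  have int: "integrable N (indicator (?E a) :: _ \<Rightarrow> real)" for a
    using E by (simp add: emeasure_eq_measure)
  have ind: "indicator {\<omega> \<in> space N. K 0 \<omega> \<le> enat k}
      = (\<lambda>\<omega>. \<Sum>a\<in>UNIV. indicator (?E a) \<omega> :: real)"
  proof
    fix \<omega>
    have "(\<Sum>a\<in>UNIV. indicator (?E a) \<omega> :: real)
        = (\<Sum>a\<in>UNIV. if a = Y 0 \<omega> then indicator {\<omega> \<in> space N. K 0 \<omega> \<le> enat k} \<omega> else 0)"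
      by (intro sum.cong) (auto simp: indicator_def)
    then show "indicator {\<omega> \<in> space N. K 0 \<omega> \<le> enat k} \<omega> = (\<Sum>a\<in>UNIV. indicator (?E a) \<omega> :: real)"
      by simp
  qed
  have "AE \<omega> in N. cond_prob_given N Y {..<0} (\<lambda>\<omega>. K 0 \<omega> \<le> enat k) \<omega>
      = (\<Sum>a\<in>UNIV. cond_prob_given N Y {..<0} (\<lambda>\<omega>. Y 0 \<omega> = a \<and> K 0 \<omega> \<le> enat k) \<omega>)"
    unfolding cond_prob_given_def ind by (rule F.real_cond_exp_sum) (rule int)
  moreover have "AE \<omega> in N. \<forall>a. cond_prob_given N Y {..<0} (\<lambda>\<omega>. Y 0 \<omega> = a \<and> K 0 \<omega> \<le> enat k) \<omega>
      = p_minus N Y a (suffix_of_past (\<lambda>n. Y n \<omega>) k)"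
    unfolding AE_all_countable
  proof
    fix a
    have "AE \<omega> in N. cond_prob_given N Y {..<0} (\<lambda>\<omega>. Y 0 \<omega> = a \<and> K 0 \<omega> \<le> enat k) \<omega>
          = cond_prob_given N Y {- int k..<0} (\<lambda>\<omega>. Y 0 \<omega> = a \<and> K 0 \<omega> \<le> enat k) \<omega> \<and>
        cond_prob_given N Y {- int k..<0} (\<lambda>\<omega>. Y 0 \<omega> = a \<and> K 0 \<omega> \<le> enat k) \<omega>
          = p_minus N Y a (suffix_of_past (\<lambda>n. Y n \<omega>) k)"
      using rep by (simp only: minimal_rcr_def)
    then show "AE \<omega> in N. cond_prob_given N Y {..<0} (\<lambda>\<omega>. Y 0 \<omega> = a \<and> K 0 \<omega> \<le> enat k) \<omega>
      = p_minus N Y a (suffix_of_past (\<lambda>n. Y n \<omega>) k)"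
      by (rule AE_mp) (auto intro!: AE_I2)
  qed
  moreover have "AE \<omega> in N. cond_prob_given N Y {..<0} (\<lambda>\<omega>. K 0 \<omega> \<le> enat k) \<omega> = g (past Y \<omega>)"
    using ver by (simp add: version_given_past_def)
  ultimately show ?thesis
    by eventually_elim (simp add: suffix_of_past_past)
qed

theorem theorem3:
  fixes M :: "'w measure" and X :: "int \<Rightarrow> 'w \<Rightarrow> 'a::finite"
    and N :: "'v measure" and Y :: "int \<Rightarrow> 'v \<Rightarrow> 'a" and K :: "int \<Rightarrow> 'v \<Rightarrow> enat"
    and G :: "nat \<Rightarrow> (int \<Rightarrow> 'a) \<Rightarrow> real"
    and \<delta> :: "nat \<Rightarrow> real"
  assumes stationary: "stationary M X"
    and ergodic: "ergodic M X"
    and continuous: "almost_surely_continuous M X"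
    and representation: "minimal_rcr N Y K"
    and same_law: "path_law N Y = path_law M X"
    and version: "\<And>k. version_given_past N Y (\<lambda>\<omega>. K 0 \<omega> \<le> enat k) (G k)"
    and delta_range: "\<And>n. n \<ge> 1 \<Longrightarrow> 0 < \<delta> n \<and> \<delta> n < 1"
    and delta_summable: "summable \<delta>"
    and delta_log: "(\<lambda>n. ln (1 / \<delta> n) / real n) \<longlonglongrightarrow> 0"
  shows "\<exists>T \<in> sets (past_law M X). measure (past_law M X) T = 1 \<and>
    (AE \<omega> in M. \<forall>x\<in>T. \<forall>k.
       (\<lambda>n. F_hat (\<lambda>i. X i \<omega>) n (\<delta> n) x k) \<longlonglongrightarrow> G k x \<and>
       (\<lambda>n. dTV (\<lambda>a. p_past M X a x) (\<lambda>a. P_hat (\<lambda>i. X i \<omega>) n (\<delta> n) a x)) \<longlonglongrightarrow> 0)"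
proof -
  interpret stationary_process M X by unfold_locales (rule stationary)
  have XY: "process M X" "process N Y"
    using stationary minimal_rcr_process[OF representation] by (auto simp: stationary_def)
  have past_law_eq: "past_law N Y = past_law M X"
    by (simp add: past_law_eq_distr_path_law[OF XY(1)] past_law_eq_distr_path_law[OF XY(2)] same_law)
  interpret L: prob_space "past_law M X"
    unfolding past_law_def by (intro prob_space_distr past_measurable XY)
  have sets_L [measurable_cong]: "sets (past_law M X) = sets past_space" by (simp add: past_law_def)
  have space_L: "space (past_law M X) = space past_space" by (simp add: past_law_def)
  have [measurable]: "G k \<in> borel_measurable past_space" for k
    using version by (simp add: version_given_past_def)
  have p_minus_measurable [measurable]: "(\<lambda>x. p_minus M X a (suffix_of_past x k)) \<in> borel_measurable past_space" for a k
    by (rule measurable_compose[OF measurable_suffix_of_past]) simp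
  let ?S = "\<lambda>x k. \<Sum>a\<in>UNIV. p_minus M X a (suffix_of_past x k)"
  \<comment> \<open>The set is fixed by the law of the past before any sample is drawn. Its last
    condition removes the null set on which the version \<open>G k\<close> differs from the sum of
    infima.\<close>
  define T where "T = {x \<in> space past_space. (\<forall>k. suffix_of_past x k \<in> supp_star M X) \<and>
    (\<forall>m. \<exists>k. 1 - 1 / real (Suc m) < ?S x k) \<and> (\<forall>k. G k x = ?S x k)}"
  have T_sets: "T \<in> sets (past_law M X)"
    unfolding T_def sets_L by measurable
  have "AE x in past_law M X. (\<forall>k. suffix_of_past x k \<in> supp_star M X) \<and>
      (\<forall>m. \<exists>k. 1 - 1 / real (Suc m) < ?S x k)"
    unfolding past_law_def
  proof (subst AE_distr_iff[OF past_measurable[OF XY(1)]])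
    show "AE \<omega> in M. (\<forall>k. suffix_of_past (past X \<omega>) k \<in> supp_star M X) \<and>
        (\<forall>m. \<exists>k. 1 - 1 / real (Suc m) < ?S (past X \<omega>) k)"
      unfolding suffix_of_past_past
      using AE_suffix_in_supp AE_sum_p_minus_near_1[OF continuous] by eventually_elim blast
  qed measurable
  \<comment> \<open>The version is given on \<open>N\<close>, so the identity is proved there and
    carried over by equality of the laws of the past.\<close>
  moreover have "AE x in past_law M X. \<forall>k. G k x = ?S x k"
    unfolding past_law_eq[symmetric] unfolding past_law_def
  proof (subst AE_distr_iff[OF past_measurable[OF XY(2)]])
    show "AE \<omega> in N. \<forall>k. G k (past Y \<omega>) = ?S (past Y \<omega>) k"
      unfolding AE_all_countable
      using version_eq_sum_p_minus[OF representation version]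
      by (simp add: p_minus_cong[OF XY same_law])
  qed measurable
  ultimately have "AE x in past_law M X. x \<in> T"
    using AE_space by eventually_elim (simp add: T_def space_L)
  then have T_full: "measure (past_law M X) T = 1"
    using T_sets by (simp add: L.AE_in_set_eq_1)
  have t: "(\<lambda>n. t_star TYPE('a) n (\<delta> n) / real n) \<longlonglongrightarrow> 0"
    using delta_range by (intro t_star_sublinear delta_log) auto
  have t_pos: "eventually (\<lambda>n. 0 \<le> t_star TYPE('a) n (\<delta> n)) sequentially"
    using eventually_ge_at_top[of 1]
    by eventually_elim (use t_star_pos(2) delta_range less_imp_le in blast)
  have conf: "AE \<omega> in M. eventually (\<lambda>n. \<forall>w a.
      lower a w \<le> p_hat (path \<omega>) n a w + cf_hat (path \<omega>) n (\<delta> n) w a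
      \<or> occ (path \<omega>) (n - 1) w = 0) sequentially"
    using delta_range by (intro eventually_confidence delta_summable) auto
  \<comment> \<open>Words are countable, so one null set of samples serves all of them; outside it
    the argument is deterministic and covers every past in \<open>T\<close>.\<close>
  have "AE \<omega> in M. \<forall>w. (\<lambda>n. real (occ (path \<omega>) n w) / real n) \<longlonglongrightarrow> word_prob w"
    unfolding AE_all_countable by (intro allI occ_frequency ergodic)
  then have "AE \<omega> in M. \<forall>x\<in>T. \<forall>k.
       (\<lambda>n. F_hat (path \<omega>) n (\<delta> n) x k) \<longlonglongrightarrow> G k x \<and>
       (\<lambda>n. dTV (\<lambda>a. p_past M X a x) (\<lambda>a. P_hat (path \<omega>) n (\<delta> n) a x)) \<longlonglongrightarrow> 0"
    using conf
  proof eventually_elim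
    case (elim \<omega>)
    show ?case
    proof (intro ballI allI)
      fix x k assume "x \<in> T"
      then have supp: "\<And>k. suffix_of_past x k \<in> supp_star M X"
        and full: "\<And>m. \<exists>k. 1 - 1 / real (Suc m) < ?S x k" and G: "G k x = ?S x k"
        by (auto simp: T_def)
      have q: "(\<lambda>n. p_hat_minus (path \<omega>) n (\<delta> n) a (suffix_of_past x k))
          \<longlonglongrightarrow> p_minus M X a (suffix_of_past x k)" for a k
        using p_hat_minus_tendsto[OF _ t elim(2) supp] elim(1) by (simp add: p_minus_on_supp supp)
      have le: "?S x k \<le> 1" for k
        using sum_p_minus_supp_le_1[OF supp] by (simp add: p_minus_on_supp supp)
      note consistent = estimators_consistent[OF t_pos q le p_past_limits[OF supp full]]
      show "(\<lambda>n. F_hat (path \<omega>) n (\<delta> n) x k) \<longlonglongrightarrow> G k x \<and>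
         (\<lambda>n. dTV (\<lambda>a. p_past M X a x) (\<lambda>a. P_hat (path \<omega>) n (\<delta> n) a x)) \<longlonglongrightarrow> 0"
        unfolding G using consistent by blast
    qed
  qed
  with T_sets T_full show ?thesis by blast
qed

end
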